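(* Let $a,b\in\mathbb{R}$. Suppose that the rotation number $r(S_{ab})$ is irrational and that the $S_{ab}$-orbit of $(0,1)$ contains $(0,-1)$. Then: (1) the $T_{ab}$-orbit of $(0,1)$ contains $(0,-1)$; (2) the closure of every nonzero orbit $\{T_{ab}^{(j)}(\mathbf{w}) : j\in\mathbb{Z}\}$, $\mathbf{w}\neq 0$, is an invariant circle of $T_{ab}$ which is a finite union of arcs of conic sections; moreover the conic arcs occurring in such an invariant circle are all of the same type: either all arcs of ellipses, or all arcs of hyperbolas, or all straight line segments.
   Context: For real parameters $a,b$, the map $T_{ab}:\mathbb{R}^2\to\mathbb{R}^2$ is $T_{ab}(x,y)=(ax-y,x)$ if $x\ge 0$ and $T_{ab}(x,y)=(bx-y,x)$ if $x<0$. It is an area-preserving homeomorphism of the plane, satisfies $T_{ab}(\lambda\mathbf{w})=\lambda T_{ab}(\mathbf{w})$ for $\lambda>0$, and maps rays from the origin onto rays from the origin. $T_{ab}^{(j)}$ denotes the $j$-th iterate of $T_{ab}$ for $j\in\mathbb{Z}$ (negative $j$ meaning iterates of $T_{ab}^{-1}$). The induced map $S_{ab}:S^1\to S^1$, $S_{ab}(\mathbf{u})=T_{ab}(\mathbf{u})/|T_{ab}(\mathbf{u})|$, is an orientation-preserving homeomorphism of the unit circle; $r(S_{ab})$ denotes its Poincaré rotation number, measured counterclockwise in units of full turns. An invariant circle of $T_{ab}$ is a simple closed curve in $\mathbb{R}^2\setminus\{0\}$ meeting every open ray from the origin in exactly one point and satisfying $T_{ab}(\mathcal{C})=\mathcal{C}$.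 *)

theory Defs
  imports "HOL-Analysis.Analysis"
begin

definition T :: "real \<Rightarrow> real \<Rightarrow> real \<times> real \<Rightarrow> real \<times> real" where
  "T a b w = (if fst w \<ge> 0 then (a * fst w - snd w, fst w) else (b * fst w - snd w, fst w))"

definition int_iter :: "('x \<Rightarrow> 'x) \<Rightarrow> ('x \<Rightarrow> 'x) \<Rightarrow> int \<Rightarrow> 'x \<Rightarrow> 'x" where
  "int_iter f finv j = (if j \<ge> 0 then f ^^ nat j else finv ^^ nat (- j))"

definition Titer :: "real \<Rightarrow> real \<Rightarrow> int \<Rightarrow> real \<times> real \<Rightarrow> real \<times> real" where
  "Titer a b j = int_iter (T a b) (inv (T a b)) j"

definition S :: "real \<Rightarrow> real \<Rightarrow> real \<times> real \<Rightarrow> real \<times> real" where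
  "S a b u = (1 / norm (T a b u)) *\<^sub>R T a b u"

definition Siter :: "real \<Rightarrow> real \<Rightarrow> int \<Rightarrow> real \<times> real \<Rightarrow> real \<times> real" where
  "Siter a b j = int_iter (S a b) (inv_into (sphere 0 1) (S a b)) j"

definition circ :: "real \<Rightarrow> real \<times> real" where
  "circ t = (cos (2 * pi * t), sin (2 * pi * t))"

text \<open>rho is a (Poincare) rotation number of the circle map f, in full turns:
  there is a continuous lift F of f with (F^n(0))/n \<longrightarrow> rho.
  (Determined modulo 1, i.e. up to the choice of lift.)\<close>
definition rotation_number :: "(real \<times> real \<Rightarrow> real \<times> real) \<Rightarrow> real \<Rightarrow> bool" where
  "rotation_number f rho \<longleftrightarrow>
     (\<exists>F. continuous_on UNIV F \<and> (\<forall>t. f (circ t) = circ (F t)) \<and>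
          (\<lambda>n. (F ^^ n) 0 / real n) \<longlonglongrightarrow> rho)"

definition invariant_circle :: "real \<Rightarrow> real \<Rightarrow> (real \<times> real) set \<Rightarrow> bool" where
  "invariant_circle a b C \<longleftrightarrow>
     (\<exists>g. simple_path g \<and> pathfinish g = pathstart g \<and> path_image g = C) \<and>
     0 \<notin> C \<and>
     (\<forall>u. u \<noteq> 0 \<longrightarrow> (\<exists>!p. p \<in> C \<and> (\<exists>t>0. p = t *\<^sub>R u))) \<and>
     T a b ` C = C"

datatype conic_type = Ellipse | Hyperbola | Line

definition lin_indep2 :: "real \<times> real \<Rightarrow> real \<times> real \<Rightarrow> bool" where
  "lin_indep2 u v \<longleftrightarrow> fst u * snd v - snd u * fst v \<noteq> 0"

definition conic_arc :: "conic_type \<Rightarrow> (real \<times> real) set \<Rightarrow> bool" where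
  "conic_arc k A \<longleftrightarrow> (\<exists>c u v t0 t1. t0 < t1 \<and>
     (case k of
        Ellipse \<Rightarrow> lin_indep2 u v \<and>
           A = (\<lambda>t. c + cos t *\<^sub>R u + sin t *\<^sub>R v) ` {t0..t1}
      | Hyperbola \<Rightarrow> lin_indep2 u v \<and>
           A = (\<lambda>t. c + cosh t *\<^sub>R u + sinh t *\<^sub>R v) ` {t0..t1}
      | Line \<Rightarrow> v \<noteq> 0 \<and> A = (\<lambda>t. c + t *\<^sub>R v) ` {t0..t1}))"

end

theory Submission
  imports Defs
begin

text \<open>
  \<open>T\<close> is linear except for shears along the rays of \<open>(0, 1)\<close> and \<open>(0, -1)\<close>, of opposite strengths.
  Reversibility shows that the \<open>T\<close>-orbit of one of these vectors reaches the other with factor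
  exactly 1, so both shears can be absorbed by bending the linear structure of the plane along the
  finitely many rays in between: on the universal cover of the punctured plane, \<open>T\<close> becomes
  linear with respect to the bent structure. There \<open>T\<close> and the full turn act as commuting
  elements of \<open>SL(2, \<real>)\<close>, and these preserve a common nonzero quadratic form, which descends to a
  \<open>T\<close>-invariant function on the plane that is quadratic on each sector. It has no zeros, because the
  zero rays would be finitely many and permuted by \<open>T\<close>. Its level sets are therefore
  invariant circles made of conic arcs whose type is given by the discriminant of the form. An orbit is dense
  in its level set because the images of a gap would have to shrink, whereas the area spanned by two
  points of the level set in the bent structure is invariant.
\<close>

section \<open>The map and its inverse\<close>

text \<open>The strength of a shear depends on the vector chosen to span its axis: scaling that
  vector by \<open>c\<close> multiplies the shear by \<open>c\<^sup>2\<close>. Moving the kink at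
  one vertical ray along the orbit therefore cancels the opposite kink at the other ray only if the
  arriving vector has length exactly 1. This is how statement (1) feeds statement (2).

  The bent structure need not close up around the origin. A full turn acts on its linear functions
  by a matrix H, in general not the identity, so the construction lives on the line covering the
  circle. A form preserved by the matrix A of \<open>T\<close> alone would not give a function on
  the plane; invariance under H is what makes it single valued.

  Irrationality is used through the absence of points that are periodic modulo 1. It rules out lifts
  of degree -1, it makes orbits infinite modulo 1, so that they accumulate, and this both forbids
  zeros of the form and yields density. It does not settle the sign of the discriminant, hence the
  three types of conics.\<close>

definition wedge :: "real \<times> real \<Rightarrow> real \<times> real \<Rightarrow> real" where
  "wedge u v = fst u * snd v - snd u * fst v"

lemma norm_circ [simp]: "norm (circ t) = 1"
  by (simp add: circ_def norm_Pair)

lemma circ_nonzero [simp]: "circ t \<noteq> 0"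
  using norm_circ[of t] by fastforce

lemma circ_eq_iff: "circ s = circ t \<longleftrightarrow> (\<exists>m::int. s = t + of_int m)"
proof
  assume "circ s = circ t"
  then have "sin (2 * pi * s) = sin (2 * pi * t) \<and> cos (2 * pi * s) = cos (2 * pi * t)"
    by (simp add: circ_def)
  then obtain n :: int where "2 * pi * s = 2 * pi * t + 2 * pi * of_int n"
    unfolding sin_cos_eq_iff by (auto elim: Ints_cases)
  then have "2 * pi * s = 2 * pi * (t + of_int n)" by (simp add: algebra_simps)
  then have "s = t + of_int n" by simp
  then show "\<exists>m::int. s = t + of_int m" ..
next
  assume "\<exists>m::int. s = t + of_int m"
  then obtain m :: int where "s = t + of_int m" by auto
  then have "2 * pi * s = 2 * pi * t + 2 * pi * of_int m" by (simp add: algebra_simps)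
  then show "circ s = circ t"
    using sin_cos_eq_iff[of "2 * pi * s" "2 * pi * t"] by (auto simp: circ_def)
qed

lemma circ_add_int [simp]: "circ (t + of_int m) = circ t"
  using circ_eq_iff by blast

lemma circ_add_1 [simp]: "circ (t + 1) = circ t"
  using circ_add_int[of t 1] by simp

lemma continuous_circ [continuous_intros]: "continuous_on A circ"
  unfolding circ_def by (intro continuous_intros)

lemma polar_coordinates:
  assumes "w \<noteq> 0"
  obtains t where "w = norm w *\<^sub>R circ t"
proof -
  have n: "norm w > 0" using assms by simp
  have "(fst w)\<^sup>2 + (snd w)\<^sup>2 = (norm w)\<^sup>2"
    by (cases w) (simp add: norm_Pair)
  then have "(fst w / norm w)\<^sup>2 + (snd w / norm w)\<^sup>2 = 1"
    using n by (simp add: power_divide flip: add_divide_distrib)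
  then obtain x where "fst w / norm w = cos x" "snd w / norm w = sin x"
    using sincos_total_2pi by blast
  then have "w = norm w *\<^sub>R circ (x / (2 * pi))"
    using n by (cases w) (simp add: circ_def field_simps)
  then show ?thesis using that by blast
qed

lemma wedge_circ: "wedge (circ t) (circ s) = sin (2 * pi * (s - t))"
  by (simp add: wedge_def circ_def sin_diff algebra_simps right_diff_distrib)

definition Tinv :: "real \<Rightarrow> real \<Rightarrow> real \<times> real \<Rightarrow> real \<times> real" where
  "Tinv a b w = (snd w, (if snd w \<ge> 0 then a else b) * snd w - fst w)"

lemma Tinv_T [simp]: "Tinv a b (T a b w) = w"
  by (cases w) (auto simp: T_def Tinv_def)

lemma T_Tinv [simp]: "T a b (Tinv a b w) = w"
  by (cases w) (auto simp: T_def Tinv_def)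

lemma inv_T: "inv (T a b) = Tinv a b"
  by (rule inv_unique_comp) (auto simp: fun_eq_iff)

lemma T_scaleR: "c \<ge> 0 \<Longrightarrow> T a b (c *\<^sub>R w) = c *\<^sub>R T a b w"
  by (cases "c = 0") (auto simp: T_def algebra_simps zero_le_mult_iff zero_prod_def)

lemma Tinv_scaleR: "c \<ge> 0 \<Longrightarrow> Tinv a b (c *\<^sub>R w) = c *\<^sub>R Tinv a b w"
  by (metis T_Tinv Tinv_T T_scaleR)

lemma T_zero [simp]: "T a b 0 = 0"
  by (simp add: T_def zero_prod_def)

lemma Tinv_zero [simp]: "Tinv a b 0 = 0"
  by (simp add: Tinv_def zero_prod_def)

lemma T_eq_0_iff [simp]: "T a b w = 0 \<longleftrightarrow> w = 0"
  by (metis T_zero Tinv_T)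

lemma Tinv_eq_0_iff [simp]: "Tinv a b w = 0 \<longleftrightarrow> w = 0"
  by (metis T_Tinv Tinv_zero)

lemma funpow_T_scaleR: "c \<ge> 0 \<Longrightarrow> (T a b ^^ n) (c *\<^sub>R w) = c *\<^sub>R (T a b ^^ n) w"
  by (induction n) (auto simp: T_scaleR)

lemma funpow_Tinv_scaleR: "c \<ge> 0 \<Longrightarrow> (Tinv a b ^^ n) (c *\<^sub>R w) = c *\<^sub>R (Tinv a b ^^ n) w"
  by (induction n) (auto simp: Tinv_scaleR)

lemma funpow_T_eq_0_iff [simp]: "(T a b ^^ n) w = 0 \<longleftrightarrow> w = 0"
  by (induction n) auto

lemma funpow_Tinv_eq_0_iff [simp]: "(Tinv a b ^^ n) w = 0 \<longleftrightarrow> w = 0"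
  by (induction n) auto

lemma funpow_Tinv_T [simp]: "(Tinv a b ^^ n) ((T a b ^^ n) w) = w"
  by (induction n arbitrary: w) (auto simp: funpow_swap1)

lemma funpow_T_Tinv [simp]: "(T a b ^^ n) ((Tinv a b ^^ n) w) = w"
  by (induction n arbitrary: w) (auto simp: funpow_swap1)

lemma S_eq_sgn: "S a b u = sgn (T a b u)"
  by (simp add: S_def sgn_div_norm divide_inverse_commute)

lemma funpow_S:
  assumes "norm u = 1"
  shows "(S a b ^^ n) u = sgn ((T a b ^^ n) u)"
proof (induction n)
  case 0
  then show ?case using assms by (simp add: sgn_div_norm)
next
  case (Suc n)
  have "norm ((T a b ^^ n) u) \<noteq> 0" using assms by auto
  with Suc show ?case
    by (simp add: S_eq_sgn sgn_div_norm T_scaleR)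
qed

lemma inj_on_S: "inj_on (S a b) (sphere 0 1)"
proof (rule inj_onI)
  fix u v :: "real \<times> real"
  assume u: "u \<in> sphere 0 1" and v: "v \<in> sphere 0 1" and eq: "S a b u = S a b v"
  define c where "c = norm (T a b u) / norm (T a b v)"
  have nz: "T a b u \<noteq> 0" "T a b v \<noteq> 0" using u v by auto
  have "T a b u = norm (T a b u) *\<^sub>R S a b u"
    using nz by (simp add: S_def)
  also have "\<dots> = c *\<^sub>R T a b v" unfolding eq by (simp add: c_def S_def)
  also have "\<dots> = T a b (c *\<^sub>R v)" by (simp add: T_scaleR c_def)
  finally have "u = c *\<^sub>R v" by (metis Tinv_T)
  moreover have "c \<ge> 0" by (simp add: c_def)
  ultimately have "c = 1" using u v by simp
  then show "u = v" using \<open>u = c *\<^sub>R v\<close> by simp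
qed

lemma inv_into_S:
  assumes "norm u = 1"
  shows "inv_into (sphere 0 1) (S a b) u = sgn (Tinv a b u)"
proof (rule inv_into_f_eq[OF inj_on_S])
  have nz: "u \<noteq> 0" using assms by auto
  then show "sgn (Tinv a b u) \<in> sphere 0 1" by (simp add: norm_sgn)
  show "S a b (sgn (Tinv a b u)) = u"
    using nz assms by (simp add: S_eq_sgn sgn_div_norm T_scaleR)
qed

lemma funpow_inv_into_S:
  assumes "norm u = 1"
  shows "(inv_into (sphere 0 1) (S a b) ^^ n) u = sgn ((Tinv a b ^^ n) u)"
proof (induction n)
  case 0
  then show ?case using assms by (simp add: sgn_div_norm)
next
  case (Suc n)
  have nz: "norm ((Tinv a b ^^ n) u) \<noteq> 0" using assms by auto
  then have "norm (sgn ((Tinv a b ^^ n) u)) = 1" by (simp add: norm_sgn)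
  then have "(inv_into (sphere 0 1) (S a b) ^^ Suc n) u = sgn (Tinv a b (sgn ((Tinv a b ^^ n) u)))"
    using Suc by (simp add: inv_into_S)
  also have "\<dots> = sgn ((Tinv a b ^^ Suc n) u)"
    using nz by (simp add: sgn_div_norm Tinv_scaleR)
  finally show ?case .
qed

lemma Tinv_swap: "Tinv a b w = prod.swap (T a b (prod.swap w))"
  by (cases w) (auto simp: T_def Tinv_def)

lemma funpow_Tinv_swap: "(Tinv a b ^^ n) w = prod.swap ((T a b ^^ n) (prod.swap w))"
  by (induction n) (auto simp: Tinv_swap)

text \<open>Reversibility: the coordinate swap conjugates \<open>T\<close> to its inverse and maps \<open>- z\<close> to \<open>T z\<close>,
  so \<open>T\<^sup>n z = - c z\<close> runs backwards to \<open>z = c\<^sup>2 z\<close>.\<close>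

lemma half_turn_factor:
  assumes z: "z = (0, 1) \<or> z = (0, -1)"
    and c: "c > 0" and n: "(T a b ^^ n) z = c *\<^sub>R (- z)"
  shows "(T a b ^^ n) z = - z"
proof -
  have Tz: "T a b z = prod.swap (- z)" "T a b (- z) = prod.swap z" using z by (auto simp: T_def)
  have "z = (Tinv a b ^^ n) (c *\<^sub>R (- z))" using n by (metis funpow_Tinv_T)
  also have "\<dots> = c *\<^sub>R (Tinv a b ^^ n) (- z)" using c by (intro funpow_Tinv_scaleR) simp
  also have "\<dots> = c *\<^sub>R prod.swap ((T a b ^^ n) (T a b z))"
    by (simp only: funpow_Tinv_swap Tz)
  also have "(T a b ^^ n) (T a b z) = T a b ((T a b ^^ n) z)" by (rule funpow_swap1[symmetric])
  also have "\<dots> = c *\<^sub>R prod.swap z" using n c by (simp add: T_scaleR Tz del: scaleR_minus_right)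
  finally have "z = c *\<^sub>R prod.swap (c *\<^sub>R prod.swap z)" .
  then have "c * c = 1" using z by auto
  then have "c = 1" using c by (simp add: square_eq_1_iff)
  then show ?thesis using n by simp
qed

text \<open>A negative \<open>j\<close> becomes a forward half turn starting at
  \<open>(0, -1)\<close>, which is why \<open>z\<close> has two possible values. Positive
  homogeneity turns the hypothesis on \<open>S\<close> into one on \<open>T\<close> up to a positive
  factor, and \<open>half_turn_factor\<close> removes the factor.\<close>

lemma half_turn_orbit:
  assumes j: "Siter a b j (0, 1) = (0, -1)"
  obtains z n where "z = (0, 1) \<or> z = (0, -1)" "(T a b ^^ n) z = - z" "Titer a b j (0, 1) = (0, -1)"
proof (cases "j \<ge> 0")
  case True
  define w where "w = (T a b ^^ nat j) (0, 1)"
  have w0: "norm w > 0" by (simp add: w_def) (simp add: zero_prod_def)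
  have "sgn w = (0, -1)" using j True by (simp add: Siter_def int_iter_def funpow_S w_def norm_Pair)
  moreover have "w = norm w *\<^sub>R sgn w" using w0 by (simp add: sgn_div_norm)
  ultimately have "w = norm w *\<^sub>R (- (0, 1))" by simp
  then have *: "(T a b ^^ nat j) (0, 1) = - (0, 1)"
    using half_turn_factor[of "(0, 1)" "norm w" "nat j" a b] w0 unfolding w_def by blast
  show ?thesis by (rule that[of "(0, 1)" "nat j"]) (use * True in \<open>auto simp: Titer_def int_iter_def\<close>)
next
  case False
  define n where "n = nat (- j)"
  define w where "w = (Tinv a b ^^ n) (0, 1)"
  have w0: "norm w > 0" by (simp add: w_def) (simp add: zero_prod_def)
  have "sgn w = (0, -1)" using j False by (simp add: Siter_def int_iter_def funpow_inv_into_S w_def n_def norm_Pair)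
  moreover have "w = norm w *\<^sub>R sgn w" using w0 by (simp add: sgn_div_norm)
  ultimately have "w = norm w *\<^sub>R (0, -1)" by simp
  then have "(0, 1) = norm w *\<^sub>R (T a b ^^ n) (0, -1)"
    by (metis funpow_T_Tinv funpow_T_scaleR norm_ge_zero w_def)
  then have "(1 / norm w) *\<^sub>R (0, 1) = (1 / norm w) *\<^sub>R norm w *\<^sub>R (T a b ^^ n) (0, -1)"
    by (rule arg_cong)
  then have "(T a b ^^ n) (0, -1) = (1 / norm w) *\<^sub>R (- (0, -1))"
    using w0 by simp
  then have *: "(T a b ^^ n) (0, -1) = - (0, -1)"
    using half_turn_factor[of "(0, -1)" "1 / norm w" n a b] w0 by simp
  then have "(Tinv a b ^^ n) (0, 1) = (0, -1)" by (metis funpow_Tinv_T minus_minus uminus_Pair add.inverse_neutral)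
  with * show ?thesis using False by (intro that[of "(0, -1)" n]) (auto simp: Titer_def int_iter_def inv_T n_def)
qed

section \<open>Lifts of circle maps with irrational rotation number\<close>

lemma shift_add_int:
  fixes F :: "real \<Rightarrow> real"
  assumes "\<And>t. F (t + 1) = F t + 1"
  shows "F (t + of_int m) = F t + of_int m"
proof (induction m rule: int_induct[where k = 0])
  case (step1 i)
  then show ?case using assms[of "t + of_int i"] by (simp add: add.assoc)
next
  case (step2 i)
  then show ?case using assms[of "t + of_int (i - 1)"] by (simp add: algebra_simps)
qed simp

lemma funpow_shift:
  fixes F :: "real \<Rightarrow> real"
  assumes "\<And>t. F (t + 1) = F t + 1"
  shows "(F ^^ n) (t + of_int m) = (F ^^ n) t + of_int m"
  by (induction n) (simp_all add: shift_add_int[where F = F, OF assms])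

text \<open>The orbit of \<open>t\<close> advances by exactly \<open>p\<close> in every
  \<open>q\<close> steps. Monotone iterates that commute with integer translations keep the orbits
  of \<open>0\<close> and \<open>t\<close> within the bound \<open>M\<close>, so the limit along
  multiples of \<open>q\<close> can be read off from \<open>t\<close>.\<close>

lemma rotation_number_periodic:
  fixes F :: "real \<Rightarrow> real"
  assumes mono: "mono F" and shift: "\<And>t. F (t + 1) = F t + 1"
    and q: "q > 0" and per: "(F ^^ q) t = t + of_int p"
    and lim: "(\<lambda>n. (F ^^ n) 0 / real n) \<longlonglongrightarrow> rho"
  shows "rho = of_int p / real q"
proof -
  define M where "M = \<lceil>\<bar>t\<bar>\<rceil>"
  have M: "of_int (- M) \<le> t" "t \<le> of_int M" unfolding M_def by linarith+
  have mono': "mono (F ^^ n)" for n using mono by (induction n) (auto simp: mono_def)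
  have near: "\<bar>(F ^^ n) 0 - (F ^^ n) t\<bar> \<le> of_int M" for n
    using monoD[OF mono' M(1), of n] monoD[OF mono' M(2), of n]
      funpow_shift[where F = F, OF shift, of n 0 M] funpow_shift[where F = F, OF shift, of n 0 "- M"] by simp
  have kq: "(F ^^ (k * q)) t = t + of_int (int k * p)" for k
  proof (induction k)
    case (Suc k)
    have "(F ^^ (Suc k * q)) t = (F ^^ q) ((F ^^ (k * q)) t)" by (simp add: funpow_add)
    also have "\<dots> = t + of_int p + of_int (int k * p)" by (simp only: Suc funpow_shift[where F = F, OF shift] per)
    finally show ?case by (simp add: algebra_simps)
  qed simp
  have "(\<lambda>k. (F ^^ (k * q)) 0 / real (k * q)) \<longlonglongrightarrow> rho"
    using LIMSEQ_subseq_LIMSEQ[OF lim, of "\<lambda>k. k * q"] q by (simp add: strict_mono_def o_def)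
  moreover have "(\<lambda>k. (F ^^ (k * q)) 0 / real (k * q)) \<longlonglongrightarrow> of_int p / real q"
  proof (rule LIM_zero_cancel, rule Lim_null_comparison)
    show "\<forall>\<^sub>F k in sequentially. norm ((F ^^ (k * q)) 0 / real (k * q) - of_int p / real q)
        \<le> (of_int M + \<bar>t\<bar>) / real k"
    proof (rule eventually_sequentiallyI[of 1])
      fix k :: nat assume k: "1 \<le> k"
      have "\<bar>(F ^^ (k * q)) 0 - real k * of_int p\<bar> \<le> of_int M + \<bar>t\<bar>"
        using near[of "k * q"] unfolding kq by simp
      moreover have "(F ^^ (k * q)) 0 / real (k * q) - of_int p / real q
          = ((F ^^ (k * q)) 0 - real k * of_int p) / real (k * q)"
        using k q by (simp add: field_simps)
      then have "\<bar>(F ^^ (k * q)) 0 / real (k * q) - of_int p / real q\<bar>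
          = \<bar>(F ^^ (k * q)) 0 - real k * of_int p\<bar> / real (k * q)"
        by (simp only: abs_divide abs_of_nat)
      moreover have "real k \<le> real (k * q)" using q by (simp only: of_nat_le_iff) simp
      ultimately show "norm ((F ^^ (k * q)) 0 / real (k * q) - of_int p / real q)
        \<le> (of_int M + \<bar>t\<bar>) / real k"
        unfolding real_norm_def using k by (auto intro!: frac_le)
    qed
    show "(\<lambda>k. (of_int M + \<bar>t\<bar>) / real k) \<longlonglongrightarrow> 0"
      by (rule lim_const_over_n)
  qed
  ultimately show ?thesis by (rule LIMSEQ_unique)
qed

text \<open>The difference \<open>F (t + 1) - F t\<close> is continuous and integer valued, hence
  constant. Its value \<open>d\<close> is left open here because the definition of
  \<open>rotation_number\<close> asks only for some continuous lift.\<close>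

lemma circle_lift_degree:
  fixes F :: "real \<Rightarrow> real"
  assumes cont: "continuous_on UNIV F" and lift: "\<And>t. f (circ t) = circ (F t)"
  obtains d :: int where "\<And>t. F (t + 1) = F t + of_int d"
proof -
  have int: "F (t + 1) - F t \<in> \<int>" for t
  proof -
    have "circ (F (t + 1)) = circ (F t)" using lift[of "t + 1"] lift[of t] by simp
    then obtain m :: int where "F (t + 1) = F t + of_int m" unfolding circ_eq_iff by blast
    then show ?thesis by simp
  qed
  have "(\<lambda>t. F (t + 1) - F t) constant_on UNIV"
  proof (rule continuous_discrete_range_constant)
    show "continuous_on UNIV (\<lambda>t. F (t + 1) - F t)"
      by (intro continuous_intros continuous_on_compose2[OF cont]) auto
    fix x :: real
    show "\<exists>e>0. \<forall>y. y \<in> UNIV \<and> F (y + 1) - F y \<noteq> F (x + 1) - F x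
            \<longrightarrow> e \<le> norm (F (y + 1) - F y - (F (x + 1) - F x))"
    proof (intro exI[of _ 1] conjI allI impI)
      fix y assume "y \<in> UNIV \<and> F (y + 1) - F y \<noteq> F (x + 1) - F x"
      moreover have "F (y + 1) - F y - (F (x + 1) - F x) \<in> \<int>" using Ints_diff[OF int[of y] int[of x]] .
      ultimately show "1 \<le> norm (F (y + 1) - F y - (F (x + 1) - F x))"
        using Ints_nonzero_abs_ge1 by force
    qed simp
  qed simp
  then obtain c where c: "\<And>t. F (t + 1) - F t = c" unfolding constant_on_def by auto
  then obtain d :: int where "c = of_int d" using int[of 0] by (metis Ints_cases)
  then show ?thesis using c that[of d] by (metis diff_add_cancel add.commute)
qed

text \<open>Preservation of orientation is obtained here from injectivity and irrationality, without
  looking at \<open>T\<close>: injectivity leaves only the degrees 1 and -1, and degree -1 would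
  produce a fixed point.\<close>

lemma irrational_rotation_lift:
  assumes rot: "rotation_number f rho" and irr: "rho \<notin> \<rat>" and inj: "inj_on f (sphere 0 1)"
  obtains F where "continuous_on UNIV F" "strict_mono F" "\<And>t. F (t + 1) = F t + 1"
    "\<And>t. f (circ t) = circ (F t)" "\<And>n t m. n > 0 \<Longrightarrow> (F ^^ n) t \<noteq> t + of_int m"
proof -
  obtain F where cont: "continuous_on UNIV F" and lift: "\<And>t. f (circ t) = circ (F t)"
    and lim: "(\<lambda>n. (F ^^ n) 0 / real n) \<longlonglongrightarrow> rho"
    using rot unfolding rotation_number_def by auto
  obtain d :: int where d: "\<And>t. F (t + 1) = F t + of_int d"
    using circle_lift_degree[OF cont lift] by blast
  have inj_mod: "\<exists>m::int. s = t + of_int m" if "F s = F t + of_int k" for s t and k :: int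
  proof -
    have "f (circ s) = f (circ t)" using that by (simp add: lift)
    then have "circ s = circ t" using inj by (simp add: inj_on_def)
    then show ?thesis by (simp add: circ_eq_iff)
  qed
  have dm: "F (t + of_int m) = F t + of_int (d * m)" for t and m :: int
  proof (induction m rule: int_induct[where k = 0])
    case (step1 i)
    then show ?case using d[of "t + of_int i"] by (simp add: algebra_simps)
  next
    case (step2 i)
    then show ?case using d[of "t + of_int (i - 1)"] by (simp add: algebra_simps)
  qed simp
  have contI: "continuous_on A F" for A using cont continuous_on_subset by blast
  \<comment> \<open>In degree 0 the value halfway between \<open>F 0\<close> and
    \<open>F (1/2)\<close> is taken in both halves of the period, at points that differ by less than
    1, against injectivity modulo 1.\<close>
  have "d \<noteq> 0"
  proof
    assume "d = 0"
    then have F01: "F 0 = F 1" using d[of 0] by simp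
    define c where "c = (F 0 + F (1/2)) / 2"
    have ne: "F 0 \<noteq> F (1/2)"
    proof
      assume "F 0 = F (1/2)"
      then obtain m :: int where "0 = (1/2::real) + of_int m" using inj_mod[of 0 "1/2" 0] by auto
      then have "of_int (2 * m + 1) = (0::real)" by simp
      then have "2 * m + 1 = 0" by (simp only: of_int_eq_0_iff)
      then show False by presburger
    qed
    obtain x where x: "0 \<le> x" "x \<le> 1/2" "F x = c"
      using IVT'[of F 0 c "1/2"] IVT2'[of F "1/2" c 0] contI unfolding c_def
      by (cases "F 0 \<le> F (1/2)") auto
    obtain y where y: "1/2 \<le> y" "y \<le> 1" "F y = c"
      using IVT'[of F "1/2" c 1] IVT2'[of F 1 c "1/2"] contI F01 unfolding c_def
      by (cases "F 0 \<le> F (1/2)") auto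
    have "x \<noteq> 0" using x ne unfolding c_def by auto
    moreover have "y \<noteq> 1/2"
    proof
      assume "y = 1/2"
      then have "F (1/2) = c" using y(3) by blast
      moreover have "u = v" if "v = (u + v) / 2" for u v :: real using that by (simp add: eq_divide_eq)
      ultimately show False using ne unfolding c_def by blast
    qed
    moreover obtain m :: int where m: "y = x + of_int m" using inj_mod[of y x 0] x y by auto
    ultimately have "0 < real_of_int m" "real_of_int m < 1" using x y by auto
    then show False by simp
  qed
  \<comment> \<open>In degree 2 or more the value \<open>F 0 + 1\<close> is taken strictly inside
    the period, at a point whose image on the circle is that of \<open>0\<close>. The lower bound is
    symmetric.\<close>
  moreover have "d \<le> 1"
  proof (rule ccontr)
    assume "\<not> d \<le> 1"
    then have "real_of_int d \<ge> 2" by linarith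
    then obtain x where x: "0 \<le> x" "x \<le> 1" "F x = F 0 + 1"
      using IVT'[of F 0 "F 0 + 1" 1] contI d[of 0] by auto
    then obtain m :: int where m: "x = of_int m" using inj_mod[of x 0 1] by auto
    then have "m = 0 \<or> m = 1" using x by auto
    then show False using m x d[of 0] \<open>real_of_int d \<ge> 2\<close> by auto
  qed
  moreover have "d \<ge> -1"
  proof (rule ccontr)
    assume "\<not> d \<ge> -1"
    then have "real_of_int d \<le> -2" by linarith
    then obtain x where x: "0 \<le> x" "x \<le> 1" "F x = F 0 - 1"
      using IVT2'[of F 1 "F 0 - 1" 0] contI d[of 0] by auto
    then obtain m :: int where m: "x = of_int m" using inj_mod[of x 0 "-1"] by auto
    then have "m = 0 \<or> m = 1" using x by auto
    then show False using m x d[of 0] \<open>real_of_int d \<le> -2\<close> by auto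
  qed
  ultimately have d1: "d = 1 \<or> d = -1" by linarith
  have "inj F"
  proof (rule injI)
    fix s t assume "F s = F t"
    moreover from this obtain m :: int where "s = t + of_int m" using inj_mod[of s t 0] by auto
    ultimately show "s = t" using dm[of t m] d1 by auto
  qed
  have mono_cases: "strict_mono F \<or> strict_antimono_on UNIV F"
    using injective_eq_monotone_map[of UNIV F] \<open>inj F\<close> cont
    by (auto simp: is_interval_univ)
  show ?thesis
  proof (cases "d = 1")
    case True
    then have shift: "F (t + 1) = F t + 1" for t using d by simp
    have "F 0 < F 1" using shift[of 0] by simp
    then have mono: "strict_mono F"
      using mono_cases by (smt (verit) UNIV_I monotone_on_def)
    have "(F ^^ n) t \<noteq> t + of_int m" if "n > 0" for n t and m :: int
      using rotation_number_periodic[OF strict_mono_mono[OF mono] shift that _ lim, of t m] irr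
      by auto
    then show ?thesis using that[OF cont mono shift lift] by blast
  next
    \<comment> \<open>In degree -1 the lift decreases and so meets the diagonal. Its square is a
      monotone lift of degree 1 with rotation number \<open>2 * rho\<close> and a fixed point, which
      would make \<open>rho\<close> rational.\<close>
    case False
    then have shift: "F (t + 1) = F t - 1" for t using d d1 by simp
    have "F 1 < F 0" using shift[of 0] by simp
    then have anti: "F t \<le> F s" if "s \<le> t" for s t
      using mono_cases that \<open>F 1 < F 0\<close> by (smt (verit) UNIV_I monotone_on_def)
    define G where "G = F \<circ> F"
    have monoG: "mono G" unfolding G_def by (auto simp: mono_def intro: anti)
    have shiftG: "G (t + 1) = G t + 1" for t
      using shift[of t] shift[of "F t - 1"] by (simp add: G_def)
    obtain K :: int where K: "\<bar>F 0\<bar> \<le> of_int K" by (meson ex_le_of_int)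
    have "F (of_int K) \<le> of_int K" using dm[of 0 K] False d1 K by auto
    moreover have "F (of_int (- K)) \<ge> of_int (- K)" using dm[of 0 "- K"] False d1 K by auto
    moreover have "of_int (-K) \<le> (of_int K :: real)" using K by simp
    moreover have "continuous_on A (\<lambda>x. F x - x)" for A by (intro continuous_intros contI)
    ultimately obtain x where x: "F x - x = 0"
      using IVT2'[of "\<lambda>x. F x - x" "of_int K" 0 "of_int (- K)"] by auto
    have pow: "(G ^^ n) t = (F ^^ (2 * n)) t" for n t
      by (induction n) (simp_all add: G_def)
    have "(\<lambda>n. 2 * ((F ^^ (2 * n)) 0 / real (2 * n))) \<longlonglongrightarrow> 2 * rho"
      using LIMSEQ_subseq_LIMSEQ[OF lim, of "\<lambda>n. 2 * n"]
      by (intro tendsto_mult_left) (simp add: strict_mono_def o_def)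
    then have "(\<lambda>n. (G ^^ n) 0 / real n) \<longlonglongrightarrow> 2 * rho" by (simp add: pow)
    moreover have "(G ^^ 1) x = x + of_int 0" using x by (simp add: G_def)
    ultimately have "2 * rho = of_int 0 / real 1"
      using rotation_number_periodic[OF monoG shiftG, of 1 x 0 "2 * rho"] by simp
    then show ?thesis using irr by simp
  qed
qed

section \<open>Bent linear structures\<close>

lemma wedge_add_left: "wedge (u + v) w = wedge u w + wedge v w"
  and wedge_add_right: "wedge u (v + w) = wedge u v + wedge u w"
  and wedge_diff_left: "wedge (u - v) w = wedge u w - wedge v w"
  and wedge_diff_right: "wedge u (v - w) = wedge u v - wedge u w"
  and wedge_scaleR_left: "wedge (c *\<^sub>R u) w = c * wedge u w"
  and wedge_scaleR_right: "wedge u (c *\<^sub>R w) = c * wedge u w"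
  and wedge_minus_right: "wedge u (- w) = - wedge u w"
  and wedge_self [simp]: "wedge u u = 0"
  and wedge_commute: "wedge u v = - wedge v u"
  by (simp_all add: wedge_def algebra_simps)

lemmas wedge_simps = wedge_add_left wedge_add_right wedge_diff_left wedge_diff_right
  wedge_scaleR_left wedge_scaleR_right wedge_minus_right

lemma continuous_wedge [continuous_intros]:
  "continuous_on A f \<Longrightarrow> continuous_on A g \<Longrightarrow> continuous_on A (\<lambda>x. wedge (f x) (g x))"
  unfolding wedge_def by (intro continuous_intros)

lemma eventually_sin_pos: "\<forall>\<^sub>F s in at_right t. sin (2 * pi * (s - t)) > 0"
proof (rule eventually_at_rightI[of t "t + 1/2"])
  fix s assume "s \<in> {t<..<t + 1/2}"
  then have "0 < s - t" "s - t < 1/2" by auto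
  then have "0 < 2 * pi * (s - t)" "2 * pi * (s - t) < 2 * pi * (1/2)"
    by (simp, intro mult_strict_left_mono) auto
  then show "sin (2 * pi * (s - t)) > 0" by (intro sin_gt_zero) auto
qed simp

lemma eventually_sin_neg: "\<forall>\<^sub>F s in at_left t. sin (2 * pi * (s - t)) < 0"
proof (rule eventually_at_leftI[of "t - 1/2" t])
  fix s assume "s \<in> {t - 1/2<..<t}"
  then have "0 < t - s" "t - s < 1/2" by auto
  then have "0 < 2 * pi * (t - s)" "2 * pi * (t - s) < 2 * pi * (1/2)"
    by (simp, intro mult_strict_left_mono) auto
  then have "sin (2 * pi * (t - s)) > 0" by (intro sin_gt_zero) auto
  moreover have "2 * pi * (s - t) = - (2 * pi * (t - s))" by (simp add: algebra_simps)
  ultimately show "sin (2 * pi * (s - t)) < 0" by (simp only: sin_minus)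
qed simp

text \<open>The transvection with axis \<open>u\<close>: it fixes \<open>u\<close> and has
  determinant 1. It is quadratic in \<open>u\<close>, which is the source of all the squared lengths
  below.\<close>

definition shear :: "real \<Rightarrow> real \<times> real \<Rightarrow> real \<times> real \<Rightarrow> real \<times> real" where
  "shear k u q = q + (k * wedge q u) *\<^sub>R u"

lemma shear_0 [simp]: "shear 0 u q = q"
  by (simp add: shear_def)

lemma shear_shear: "shear k u (shear l u q) = shear (k + l) u q"
  by (simp add: shear_def wedge_simps algebra_simps)

lemma shear_eq_iff [simp]: "shear k u q = shear k u q' \<longleftrightarrow> q = q'"
  by (metis shear_shear shear_0 add.left_inverse)

lemma wedge_shear [simp]: "wedge (shear k u q) u = wedge q u"
  by (simp add: shear_def wedge_simps)

lemma wedge_shear_shear [simp]: "wedge (shear k u q) (shear k u q') = wedge q q'"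
  by (simp add: shear_def wedge_def algebra_simps)

lemma shear_linear: "shear k u (x *\<^sub>R q + y *\<^sub>R q') = x *\<^sub>R shear k u q + y *\<^sub>R shear k u q'"
  by (simp add: shear_def wedge_simps algebra_simps)

lemma shear_scaleR: "shear k (c *\<^sub>R u) q = shear (c\<^sup>2 * k) u q"
  by (simp add: shear_def wedge_simps power2_eq_square algebra_simps)

text \<open>The value at \<open>t\<close> is the one valid on the right, and the shear leads from
  the left value to it. This convention decides which side of a kink may contain the base point
  \<open>0\<close> in the existence proof.\<close>

definition kink_at :: "(real \<Rightarrow> real) \<Rightarrow> (real \<Rightarrow> real \<times> real) \<Rightarrow> real \<Rightarrow> bool" where
  "kink_at \<kappa> p t \<longleftrightarrow> (\<forall>\<^sub>F s in at_right t. p s = p t) \<and>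
     (\<exists>q. (\<forall>\<^sub>F s in at_left t. p s = q) \<and> p t = shear (\<kappa> t) (circ t) q)"

text \<open>A solution \<open>p\<close> is a step function whose value at \<open>t\<close> represents a linear functional
  \<open>w \<mapsto> wedge (p t) w\<close> near the ray in direction \<open>circ t\<close>. The jump condition makes
  \<open>wedge (p t) (circ t)\<close> continuous: these are the functions that are linear for the linear
  structure bent by the shear \<open>\<kappa> t\<close> along that ray.\<close>

definition solves :: "(real \<Rightarrow> real) \<Rightarrow> (real \<Rightarrow> real \<times> real) \<Rightarrow> bool" where
  "solves \<kappa> p \<longleftrightarrow> (\<forall>t. kink_at \<kappa> p t)"

lemma kink_at_cong:
  assumes ev: "\<forall>\<^sub>F s in at t. p s = p' s" and eq: "p t = p' t" "\<kappa> t = \<kappa>' t" and kink: "kink_at \<kappa> p t"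
  shows "kink_at \<kappa>' p' t"
proof -
  obtain q where r: "\<forall>\<^sub>F s in at_right t. p s = p t" and l: "\<forall>\<^sub>F s in at_left t. p s = q"
    and q: "p t = shear (\<kappa> t) (circ t) q"
    using kink unfolding kink_at_def by auto
  have evr: "\<forall>\<^sub>F s in at_right t. p s = p' s" and evl: "\<forall>\<^sub>F s in at_left t. p s = p' s"
    using ev unfolding eventually_at_split by auto
  have "\<forall>\<^sub>F s in at_right t. p' s = p' t"
    using r evr by eventually_elim (use eq in simp)
  moreover have "\<forall>\<^sub>F s in at_left t. p' s = q" using l evl by eventually_elim simp
  ultimately show ?thesis using q eq unfolding kink_at_def by (intro conjI exI[of _ q]) simp_all
qed

lemma kink_at_linear:
  assumes "kink_at \<kappa> p t" "kink_at \<kappa> p' t"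
  shows "kink_at \<kappa> (\<lambda>t. x *\<^sub>R p t + y *\<^sub>R p' t) t"
proof -
  obtain q q' where ev: "\<forall>\<^sub>F s in at_right t. p s = p t" "\<forall>\<^sub>F s in at_left t. p s = q"
     "\<forall>\<^sub>F s in at_right t. p' s = p' t" "\<forall>\<^sub>F s in at_left t. p' s = q'"
    and q: "p t = shear (\<kappa> t) (circ t) q" "p' t = shear (\<kappa> t) (circ t) q'"
    using assms unfolding kink_at_def by auto
  have "\<forall>\<^sub>F s in at_right t. x *\<^sub>R p s + y *\<^sub>R p' s = x *\<^sub>R p t + y *\<^sub>R p' t"
    using ev(1,3) by eventually_elim simp
  moreover have "\<forall>\<^sub>F s in at_left t. x *\<^sub>R p s + y *\<^sub>R p' s = x *\<^sub>R q + y *\<^sub>R q'"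
    using ev(2,4) by eventually_elim simp
  ultimately show ?thesis unfolding kink_at_def shear_linear[symmetric] q by blast
qed

text \<open>Shears are injective, so agreement at \<open>t\<close> is equivalent to agreement on
  either side. Hence the agreement set and its complement are both open, and connectedness yields
  uniqueness. The analogue for \<open>wedge\<close> below rests on determinant 1.\<close>

lemma kink_at_local_eq:
  assumes "kink_at \<kappa> p t" "kink_at \<kappa>' p' t" "\<kappa> t = \<kappa>' t"
  shows "\<forall>\<^sub>F s in at t. (p t = p' t) = (p s = p' s)"
proof -
  obtain q q' where ev: "\<forall>\<^sub>F s in at_right t. p s = p t" "\<forall>\<^sub>F s in at_left t. p s = q"
     "\<forall>\<^sub>F s in at_right t. p' s = p' t" "\<forall>\<^sub>F s in at_left t. p' s = q'"
    and q: "p t = shear (\<kappa> t) (circ t) q" "p' t = shear (\<kappa> t) (circ t) q'"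
    using assms unfolding kink_at_def by auto
  have "\<forall>\<^sub>F s in at_right t. (p t = p' t) = (p s = p' s)"
    using ev(1,3) by eventually_elim simp
  moreover have "\<forall>\<^sub>F s in at_left t. (p t = p' t) = (p s = p' s)"
    using ev(2,4) by eventually_elim (simp add: q)
  ultimately show ?thesis by (simp add: eventually_at_split)
qed

lemma kink_at_local_wedge:
  assumes "kink_at \<kappa> p t" "kink_at \<kappa> p' t"
  shows "\<forall>\<^sub>F s in at t. wedge (p t) (p' t) = wedge (p s) (p' s)"
proof -
  obtain q q' where ev: "\<forall>\<^sub>F s in at_right t. p s = p t" "\<forall>\<^sub>F s in at_left t. p s = q"
     "\<forall>\<^sub>F s in at_right t. p' s = p' t" "\<forall>\<^sub>F s in at_left t. p' s = q'"
    and q: "p t = shear (\<kappa> t) (circ t) q" "p' t = shear (\<kappa> t) (circ t) q'"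
    using assms unfolding kink_at_def by auto
  have "\<forall>\<^sub>F s in at_right t. wedge (p t) (p' t) = wedge (p s) (p' s)"
    using ev(1,3) by eventually_elim simp
  moreover have "\<forall>\<^sub>F s in at_left t. wedge (p t) (p' t) = wedge (p s) (p' s)"
    using ev(2,4) by eventually_elim (simp add: q)
  ultimately show ?thesis by (simp add: eventually_at_split)
qed

text \<open>Stated on an interval around \<open>0\<close> with two kink functions because the
  existence proof has to compare solutions for different truncations of the same kinks.\<close>

lemma kink_unique:
  assumes "\<And>t. \<bar>t\<bar> < c \<Longrightarrow> kink_at \<kappa> p t" "\<And>t. \<bar>t\<bar> < c \<Longrightarrow> kink_at \<kappa>' p' t"
    and "\<And>t. \<bar>t\<bar> < c \<Longrightarrow> \<kappa> t = \<kappa>' t" and "p 0 = p' 0" and s: "\<bar>s\<bar> < c"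
  shows "p s = p' s"
proof -
  have "(p 0 = p' 0) = (p s = p' s)"
  proof (rule connected_local_const[of "{-c<..<c}"])
    show "\<forall>a\<in>{-c<..<c}. \<forall>\<^sub>F b in at a within {-c<..<c}. (p a = p' a) = (p b = p' b)"
    proof
      fix a assume "a \<in> {-c<..<c}"
      then have "\<bar>a\<bar> < c" by auto
      then have "\<forall>\<^sub>F b in at a. (p a = p' a) = (p b = p' b)"
        using assms kink_at_local_eq by blast
      then show "\<forall>\<^sub>F b in at a within {-c<..<c}. (p a = p' a) = (p b = p' b)"
        by (rule filter_leD[OF at_le[OF subset_UNIV]])
    qed
  qed (use s in auto)
  then show ?thesis using assms by simp
qed

lemma solves_unique:
  assumes "solves \<kappa> p" "solves \<kappa> p'" "p 0 = p' 0"
  shows "p = p'"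
proof
  fix s show "p s = p' s"
    by (rule kink_unique[of "\<bar>s\<bar> + 1" \<kappa> p \<kappa> p']) (use assms in \<open>auto simp: solves_def\<close>)
qed

lemma solves_wedge_const:
  assumes "solves \<kappa> p" "solves \<kappa> p'"
  shows "wedge (p s) (p' s) = wedge (p 0) (p' 0)"
proof (rule connected_local_const[where A = UNIV and f = "\<lambda>s. wedge (p s) (p' s)"])
  show "\<forall>a\<in>UNIV. \<forall>\<^sub>F b in at a. wedge (p a) (p' a) = wedge (p b) (p' b)"
    using assms kink_at_local_wedge unfolding solves_def by blast
qed auto

lemma solves_linear: "solves \<kappa> p \<Longrightarrow> solves \<kappa> p' \<Longrightarrow> solves \<kappa> (\<lambda>t. x *\<^sub>R p t + y *\<^sub>R p' t)"
  unfolding solves_def using kink_at_linear by blast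

text \<open>Induction on the number of kinks: an outermost kink is removed, the smaller problem is
  solved, and the solution is sheared beyond that kink on the side away from \<open>0\<close>, so
  that the initial value survives.\<close>

lemma solves_exists_finite:
  assumes "finite Z" "\<And>t. t \<notin> Z \<Longrightarrow> \<kappa> t = 0"
  shows "\<exists>p. solves \<kappa> p \<and> p 0 = p0"
  using assms
proof (induction "card Z" arbitrary: Z \<kappa>)
  case 0
  then have "\<kappa> t = 0" for t by auto
  then have "solves \<kappa> (\<lambda>_. p0)" by (auto simp: solves_def kink_at_def)
  then show ?case by blast
next
  case (Suc n)
  then have ne: "Z \<noteq> {}" by auto
  have ih: "\<exists>p. solves (\<kappa>(z := 0)) p \<and> p 0 = p0" if "z \<in> Z" for z
    by (rule Suc.hyps(1)[of "Z - {z}"]) (use Suc that in auto)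
  \<comment> \<open>A rightmost kink has to be strictly positive, since the new solution changes at
    \<open>z\<close> itself. A leftmost kink may sit at \<open>0\<close>, since there only values
    strictly to the left of \<open>z\<close> change.\<close>
  show ?case
  proof (cases "Max Z > 0")
    case True
    define z where "z = Max Z"
    have z: "z \<in> Z" "z > 0" "\<And>t. t > z \<Longrightarrow> \<kappa> t = 0"
      using Max_in[OF Suc.prems(1) ne] Max_ge[OF Suc.prems(1)] Suc.prems(2) True
      unfolding z_def by (blast, simp, meson not_le)
    obtain p where p: "solves (\<kappa>(z := 0)) p" "p 0 = p0" using ih z by blast
    define p' where "p' t = (if t < z then p t else shear (\<kappa> z) (circ z) (p z))" for t
    have "kink_at \<kappa> p' t" for t
    proof (cases t z rule: linorder_cases)
      case less
      have "\<forall>\<^sub>F s in at t. p s = p' s"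
        using order_tendstoD(2)[OF tendsto_ident_at less] by eventually_elim (simp add: p'_def)
      moreover have "kink_at (\<kappa>(z := 0)) p t" using p by (simp add: solves_def)
      ultimately show ?thesis using less by (elim kink_at_cong) (auto simp: p'_def)
    next
      case equal
      have "kink_at (\<kappa>(z := 0)) p z" using p by (simp add: solves_def)
      then have l: "\<forall>\<^sub>F s in at_left z. p s = p z" by (auto simp: kink_at_def simp del: split_paired_Ex)
      have "\<forall>\<^sub>F s in at_left z. s < z" by (simp add: eventually_at_filter)
      with l have "\<forall>\<^sub>F s in at_left z. p' s = p z" by eventually_elim (simp add: p'_def)
      moreover have "\<forall>\<^sub>F s in at_right z. s > z" by (simp add: eventually_at_filter)
      then have "\<forall>\<^sub>F s in at_right z. p' s = p' z" by eventually_elim (simp add: p'_def)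
      ultimately show ?thesis unfolding equal kink_at_def by (auto simp: p'_def simp del: split_paired_Ex)
    next
      case greater
      have "\<forall>\<^sub>F s in at t. shear (\<kappa> z) (circ z) (p z) = p' s"
        using order_tendstoD(1)[OF tendsto_ident_at greater] by eventually_elim (simp add: p'_def)
      moreover have "kink_at \<kappa> (\<lambda>_. shear (\<kappa> z) (circ z) (p z)) t"
        using z(3)[OF greater] by (simp add: kink_at_def)
      ultimately show ?thesis using greater by (elim kink_at_cong) (auto simp: p'_def)
    qed
    moreover have "p' 0 = p0" using z p by (simp add: p'_def)
    ultimately show ?thesis unfolding solves_def by blast
  next
    case False
    define z where "z = Min Z"
    have "z \<le> Max Z" using Suc.prems(1) ne by (simp add: z_def)
    then have z: "z \<in> Z" "z \<le> 0" "\<And>t. t < z \<Longrightarrow> \<kappa> t = 0"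
      using Min_in[OF Suc.prems(1) ne] Min_le[OF Suc.prems(1)] Suc.prems(2) False
      unfolding z_def by (blast, simp, meson not_le)
    obtain p where p: "solves (\<kappa>(z := 0)) p" "p 0 = p0" using ih z by blast
    define p' where "p' t = (if t < z then shear (- \<kappa> z) (circ z) (p z) else p t)" for t
    have "kink_at \<kappa> p' t" for t
    proof (cases t z rule: linorder_cases)
      case greater
      have "\<forall>\<^sub>F s in at t. p s = p' s"
        using order_tendstoD(1)[OF tendsto_ident_at greater] by eventually_elim (simp add: p'_def)
      moreover have "kink_at (\<kappa>(z := 0)) p t" using p by (simp add: solves_def)
      ultimately show ?thesis using greater by (elim kink_at_cong) (auto simp: p'_def)
    next
      case equal
      have "kink_at (\<kappa>(z := 0)) p z" using p by (simp add: solves_def)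
      then have r: "\<forall>\<^sub>F s in at_right z. p s = p z" by (simp add: kink_at_def)
      have "\<forall>\<^sub>F s in at_right z. s > z" by (simp add: eventually_at_filter)
      with r have "\<forall>\<^sub>F s in at_right z. p' s = p' z" by eventually_elim (simp add: p'_def)
      moreover have "\<forall>\<^sub>F s in at_left z. s < z" by (simp add: eventually_at_filter)
      then have "\<forall>\<^sub>F s in at_left z. p' s = shear (- \<kappa> z) (circ z) (p z)"
        by eventually_elim (simp add: p'_def)
      moreover have "p' z = p z" by (simp add: p'_def)
      ultimately show ?thesis unfolding equal kink_at_def
        by (intro conjI exI[of _ "shear (- \<kappa> z) (circ z) (p z)"]) (simp_all add: shear_shear)
    next
      case less
      have "\<forall>\<^sub>F s in at t. shear (- \<kappa> z) (circ z) (p z) = p' s"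
        using order_tendstoD(2)[OF tendsto_ident_at less] by eventually_elim (simp add: p'_def)
      moreover have "kink_at \<kappa> (\<lambda>_. shear (- \<kappa> z) (circ z) (p z)) t"
        using z(3)[OF less] by (simp add: kink_at_def)
      ultimately show ?thesis using less by (elim kink_at_cong) (auto simp: p'_def)
    qed
    moreover have "p' 0 = p0" using z p by (simp add: p'_def)
    ultimately show ?thesis unfolding solves_def by blast
  qed
qed

text \<open>The solutions for the kinks truncated to \<open>\<bar>t\<bar> < n\<close> agree where
  two of the intervals overlap, by \<open>kink_unique\<close>, and are glued.\<close>

lemma solves_exists:
  assumes fin: "\<And>n::nat. finite {t. \<bar>t\<bar> < real n \<and> \<kappa> t \<noteq> 0}"
  obtains p where "solves \<kappa> p" "p 0 = p0"
proof -
  define \<kappa>' where "\<kappa>' n t = (if \<bar>t\<bar> < real n then \<kappa> t else 0)" for n t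
  have "\<exists>p. solves (\<kappa>' n) p \<and> p 0 = p0" for n
    by (rule solves_exists_finite[OF fin[of n]]) (auto simp: \<kappa>'_def)
  then obtain P where P: "\<And>n. solves (\<kappa>' n) (P n)" "\<And>n. P n 0 = p0" by metis
  have coherent: "P n s = P m s" if "\<bar>s\<bar> < real n" "\<bar>s\<bar> < real m" for n m s
    by (rule kink_unique[of "real (min n m)" "\<kappa>' n" "P n" "\<kappa>' m" "P m"])
      (use P that in \<open>auto simp: solves_def \<kappa>'_def\<close>)
  define p where "p s = P (nat \<lceil>\<bar>s\<bar>\<rceil> + 1) s" for s
  have p_eq: "p s = P n s" if "\<bar>s\<bar> < real n" for n s
    unfolding p_def by (rule coherent) (use that in linarith)+
  have "kink_at \<kappa> p t" for t
  proof -
    define n where "n = nat \<lceil>\<bar>t\<bar>\<rceil> + 1"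
    have n: "\<bar>t\<bar> < real n" unfolding n_def by linarith
    have "((\<lambda>s. \<bar>s\<bar>) \<longlongrightarrow> \<bar>t\<bar>) (at t)" by (intro tendsto_intros)
    from order_tendstoD(2)[OF this n] have "\<forall>\<^sub>F s in at t. P n s = p s"
      by eventually_elim (simp add: p_eq)
    then show ?thesis
      by (rule kink_at_cong[of _ _ _ "\<kappa>' n"]) (use P n in \<open>auto simp: p_eq \<kappa>'_def solves_def\<close>)
  qed
  moreover have "p 0 = p0" using p_eq[of 0 1] P by simp
  ultimately show ?thesis using that unfolding solves_def by blast
qed

text \<open>The axis of the shear at \<open>t\<close> is \<open>circ t\<close> itself, so the jump
  of \<open>p\<close> is invisible in the pairing with \<open>circ t\<close>.\<close>

lemma solution_continuous:
  assumes "solves \<kappa> p"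
  shows "continuous_on A (\<lambda>t. wedge (p t) (circ t))"
proof -
  have "isCont (\<lambda>t. wedge (p t) (circ t)) t" for t
  proof -
    obtain q where r: "\<forall>\<^sub>F s in at_right t. p s = p t" and l: "\<forall>\<^sub>F s in at_left t. p s = q"
      and q: "p t = shear (\<kappa> t) (circ t) q"
      using assms unfolding solves_def kink_at_def by metis
    have lim: "((\<lambda>s. wedge u (circ s)) \<longlongrightarrow> wedge u (circ t)) (at t)" for u
      using continuous_wedge[OF continuous_on_const continuous_circ, of UNIV u]
      by (auto simp: continuous_on_def)
    have "((\<lambda>s. wedge (p s) (circ s)) \<longlongrightarrow> wedge (p t) (circ t)) (at_right t)"
    proof (rule Lim_transform_eventually)
      show "((\<lambda>s. wedge (p t) (circ s)) \<longlongrightarrow> wedge (p t) (circ t)) (at_right t)"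
        by (rule tendsto_mono[OF _ lim]) (simp add: at_le)
      show "\<forall>\<^sub>F s in at_right t. wedge (p t) (circ s) = wedge (p s) (circ s)"
        using r by eventually_elim simp
    qed
    moreover have "((\<lambda>s. wedge (p s) (circ s)) \<longlongrightarrow> wedge (p t) (circ t)) (at_left t)"
    proof (rule Lim_transform_eventually)
      show "((\<lambda>s. wedge q (circ s)) \<longlongrightarrow> wedge (p t) (circ t)) (at_left t)"
        unfolding q wedge_shear by (rule tendsto_mono[OF _ lim]) (simp add: at_le)
      show "\<forall>\<^sub>F s in at_left t. wedge q (circ s) = wedge (p s) (circ s)"
        using l by eventually_elim simp
    qed
    ultimately show ?thesis by (simp add: isCont_def filterlim_split_at)
  qed
  then show ?thesis by (simp add: continuous_at_imp_continuous_on)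
qed

section \<open>Pulling solutions back along the map\<close>

locale circle_lift =
  fixes a b :: real and F :: "real \<Rightarrow> real"
  assumes cont: "continuous_on UNIV F" and mono: "strict_mono F"
    and shift: "F (t + 1) = F t + 1"
    and lift: "S a b (circ t) = circ (F t)"
    and aperiodic: "n > 0 \<Longrightarrow> (F ^^ n) t \<noteq> t + of_int m"
begin

definition r :: "real \<Rightarrow> real" where
  "r t = norm (T a b (circ t))"

lemma r_pos: "r t > 0"
  by (simp add: r_def)

lemma T_circ: "T a b (circ t) = r t *\<^sub>R circ (F t)"
  using r_pos[of t] unfolding lift[symmetric] S_def r_def by simp

lemma F_add_int: "F (t + of_int m) = F t + of_int m"
  using shift_add_int[of F t m] shift by blast

lemma funpow_F_add_int: "(F ^^ n) (t + of_int m) = (F ^^ n) t + of_int m"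
  using funpow_shift[of F n t m] shift by blast

lemma F_less_iff [simp]: "F s < F t \<longleftrightarrow> s < t"
  using mono by (rule strict_mono_less)

lemma F_eq_iff [simp]: "F s = F t \<longleftrightarrow> s = t"
  using mono by (rule strict_mono_eq)

lemma F_tendsto: "(F \<longlongrightarrow> F t) (at t within A)"
proof (rule tendsto_mono)
  show "at t within A \<le> at t" by (rule at_le) simp
  show "(F \<longlongrightarrow> F t) (at t)" using cont by (simp add: continuous_on_def)
qed

lemma F_at_right: "filterlim F (at_right (F t)) (at_right t)"
  unfolding filterlim_at using F_tendsto by (auto simp: eventually_at_filter)

lemma F_at_left: "filterlim F (at_left (F t)) (at_left t)"
  unfolding filterlim_at using F_tendsto by (auto simp: eventually_at_filter)

lemma bij_F: "bij F"
proof (rule bijI)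
  show "inj F" using mono by (rule strict_mono_imp_inj_on)
  show "surj F"
    unfolding surj_def
  proof
    fix y
    define m where "m = \<lceil>\<bar>y\<bar> + \<bar>F 0\<bar>\<rceil>"
    have "F (of_int (- m)) \<le> y" "y \<le> F (of_int m)"
      using F_add_int[of 0 m] F_add_int[of 0 "- m"] le_of_int_ceiling[of "\<bar>y\<bar> + \<bar>F 0\<bar>"]
      unfolding m_def[symmetric] by simp_all
    moreover have "of_int (- m) \<le> (of_int m :: real)" unfolding m_def by linarith
    ultimately show "\<exists>x. y = F x"
      using IVT'[of F "of_int (- m)" y "of_int m"] continuous_on_subset[OF cont] by blast
  qed
qed

text \<open>Aperiodicity makes the fractional parts of a forward orbit pairwise distinct, so they
  form an infinite subset of a compact interval.\<close>

lemma orbit_limit_point: "\<exists>x. x islimpt {(F ^^ n) t + of_int m |n m. True}"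
proof -
  define g where "g n = frac ((F ^^ n) t)" for n
  have ne: "g i \<noteq> g j" if "i < j" for i j
  proof
    assume "g i = g j"
    define m where "m = \<lfloor>(F ^^ j) t\<rfloor> - \<lfloor>(F ^^ i) t\<rfloor>"
    have m: "(F ^^ j) t = (F ^^ i) t + of_int m"
      using \<open>g i = g j\<close> by (simp add: g_def frac_def m_def)
    have "(F ^^ (j - i)) ((F ^^ i) t) = (F ^^ j) t"
      using that by (simp flip: funpow_add[THEN fun_cong, unfolded o_apply])
    then show False using m aperiodic[of "j - i" "(F ^^ i) t" m] that by simp
  qed
  then have "inj g" by (metis injI linorder_neqE_nat)
  then have inf: "infinite (range g)" by (rule range_inj_infinite)
  have "range g \<subseteq> {0..1}" by (auto simp: g_def frac_ge_0 less_imp_le[OF frac_lt_1])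
  then obtain x where "x islimpt range g"
    using inf compact_Icc[of 0 "1::real"] unfolding compact_eq_Bolzano_Weierstrass by blast
  moreover have "range g \<subseteq> {(F ^^ n) t + of_int m |n m. True}"
  proof
    fix y assume "y \<in> range g"
    then obtain n where "y = (F ^^ n) t + of_int (- \<lfloor>(F ^^ n) t\<rfloor>)" by (auto simp: g_def frac_def)
    then show "y \<in> {(F ^^ n) t + of_int m |n m. True}" by blast
  qed
  ultimately show ?thesis using islimpt_subset by blast
qed

text \<open>The coefficient of the branch of \<open>T\<close> valid just counterclockwise of
  \<open>circ t\<close>; \<open>left_coeff\<close> belongs to the clockwise side. Counterclockwise
  of \<open>(0, 1)\<close> lies the half plane of negative abscissas, hence \<open>b\<close> there
  and \<open>a\<close> at \<open>(0, -1)\<close>.\<close>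

definition right_coeff :: "real \<Rightarrow> real" where
  "right_coeff t = (if fst (circ t) > 0 \<or> circ t = (0, -1) then a else b)"

definition left_coeff :: "real \<Rightarrow> real" where
  "left_coeff t = (if fst (circ t) > 0 \<or> circ t = (0, 1) then a else b)"

definition linT :: "real \<Rightarrow> real \<times> real \<Rightarrow> real \<times> real" where
  "linT c w = (c * fst w - snd w, fst w)"

definition linTinv :: "real \<Rightarrow> real \<times> real \<Rightarrow> real \<times> real" where
  "linTinv c w = (snd w, c * snd w - fst w)"

lemma wedge_linTinv_linTinv [simp]: "wedge (linTinv c u) (linTinv c w) = wedge u w"
  by (simp add: wedge_def linTinv_def algebra_simps)

lemma wedge_linTinv: "wedge (linTinv c u) w = wedge u (linT c w)"
  by (simp add: wedge_def linTinv_def linT_def algebra_simps)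

lemma linTinv_linear: "linTinv c (x *\<^sub>R u + y *\<^sub>R v) = x *\<^sub>R linTinv c u + y *\<^sub>R linTinv c v"
  by (simp add: linTinv_def algebra_simps)

text \<open>Conjugating a transvection by a matrix of determinant 1 moves its axis and keeps its
  strength.\<close>

lemma linTinv_shear: "linTinv c (shear k (linT c u) q) = shear k u (linTinv c q)"
  by (cases u) (simp add: linTinv_def linT_def shear_def wedge_def algebra_simps)

lemma circ_vertical:
  assumes "fst (circ t) = 0"
  shows "circ t = (0, 1) \<or> circ t = (0, -1)"
proof -
  have "cos (2 * pi * t) = 0" using assms by (simp add: circ_def)
  then have "sin (2 * pi * t) = 1 \<or> sin (2 * pi * t) = -1"
    using sin_cos_squared_add[of "2 * pi * t"] by (auto simp: power2_eq_1_iff)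
  then show ?thesis using assms by (auto simp: circ_def)
qed

lemma linT_right: "linT (right_coeff t) (circ t) = T a b (circ t)"
  and linT_left: "linT (left_coeff t) (circ t) = T a b (circ t)"
  using circ_vertical[of t]
  by (cases "fst (circ t)" "0 :: real" rule: linorder_cases;
      auto simp: linT_def right_coeff_def left_coeff_def T_def)+

lemma fst_circ_tendsto: "((\<lambda>s. fst (circ s)) \<longlongrightarrow> fst (circ t)) (at t within A)"
proof (rule tendsto_mono)
  show "at t within A \<le> at t" by (rule at_le) simp
  have "continuous_on UNIV (\<lambda>s. fst (circ s))" by (intro continuous_intros)
  then show "((\<lambda>s. fst (circ s)) \<longlongrightarrow> fst (circ t)) (at t)" by (simp add: continuous_on_def)
qed

lemma coeff_const:
  "\<forall>\<^sub>F s in at_right t. right_coeff s = right_coeff t"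
  "\<forall>\<^sub>F s in at_left t. right_coeff s = left_coeff t"
proof -
  have "(\<forall>\<^sub>F s in at_right t. right_coeff s = right_coeff t) \<and>
    (\<forall>\<^sub>F s in at_left t. right_coeff s = left_coeff t)"
  proof (cases "fst (circ t)" "0 :: real" rule: linorder_cases)
    case less
    have "\<forall>\<^sub>F s in at t within A. right_coeff s = b" for A
      using order_tendstoD(2)[OF fst_circ_tendsto less]
      by eventually_elim (auto simp: right_coeff_def)
    then show ?thesis using less by (auto simp: right_coeff_def left_coeff_def)
  next
    case greater
    have "\<forall>\<^sub>F s in at t within A. right_coeff s = a" for A
      using order_tendstoD(1)[OF fst_circ_tendsto greater]
      by eventually_elim (auto simp: right_coeff_def)
    then show ?thesis using greater by (auto simp: right_coeff_def left_coeff_def)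
  next
    case equal
    have s: "sin (2 * pi * (s - t)) = - snd (circ t) * fst (circ s)" for s
      using equal by (simp add: wedge_def flip: wedge_circ)
    from circ_vertical[OF equal] show ?thesis
    proof
      assume t: "circ t = (0, 1)"
      have "\<forall>\<^sub>F s in at_right t. right_coeff s = b"
        using eventually_sin_pos[of t] unfolding s
        by eventually_elim (auto simp: right_coeff_def t)
      moreover have "\<forall>\<^sub>F s in at_left t. right_coeff s = a"
        using eventually_sin_neg[of t] unfolding s
        by eventually_elim (auto simp: right_coeff_def t)
      ultimately show ?thesis by (simp add: right_coeff_def left_coeff_def t)
    next
      assume t: "circ t = (0, -1)"
      have "\<forall>\<^sub>F s in at_right t. right_coeff s = a"
        using eventually_sin_pos[of t] unfolding s
        by eventually_elim (auto simp: right_coeff_def t)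
      moreover have "\<forall>\<^sub>F s in at_left t. right_coeff s = b"
        using eventually_sin_neg[of t] unfolding s
        by eventually_elim (auto simp: right_coeff_def t)
      ultimately show ?thesis by (simp add: right_coeff_def left_coeff_def t)
    qed
  qed
  then show "\<forall>\<^sub>F s in at_right t. right_coeff s = right_coeff t"
    "\<forall>\<^sub>F s in at_left t. right_coeff s = left_coeff t" by auto
qed

text \<open>The strength of the shear by which the inverses of the two branches of \<open>T\<close>
  differ across the ray of \<open>circ t\<close>, as computed in
  \<open>linTinv_right_left\<close>.\<close>

definition T_kink :: "real \<Rightarrow> real" where
  "T_kink t = (if circ t = (0, 1) then b - a else if circ t = (0, -1) then a - b else 0)"

lemma linTinv_right_left: "linTinv (right_coeff t) q = shear (T_kink t) (circ t) (linTinv (left_coeff t) q)"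
  using circ_vertical[of t]
  by (auto simp: linTinv_def right_coeff_def left_coeff_def T_kink_def shear_def wedge_def algebra_simps)

text \<open>Composition of a functional with \<open>T\<close>: \<open>linTinv c\<close> is the
  adjoint of \<open>linT c\<close> for \<open>wedge\<close>. The right branch is used to match the
  right-hand convention of \<open>kink_at\<close>.\<close>

definition pull :: "(real \<Rightarrow> real \<times> real) \<Rightarrow> real \<Rightarrow> real \<times> real" where
  "pull p t = linTinv (right_coeff t) (p (F t))"

lemma pull_linear: "pull (\<lambda>t. x *\<^sub>R p t + y *\<^sub>R p' t) t = x *\<^sub>R pull p t + y *\<^sub>R pull p' t"
  by (simp add: pull_def linTinv_linear)

lemma wedge_pull: "wedge (pull p t) (circ t) = r t * wedge (p (F t)) (circ (F t))"
  by (simp add: pull_def wedge_linTinv linT_right T_circ wedge_simps)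

lemma pull_add_1: "pull (\<lambda>t. p (t + 1)) t = pull p (t + 1)"
  by (simp add: pull_def shift right_coeff_def)

text \<open>The pullback meets the kink of \<open>T\<close> at \<open>t\<close> and, transported
  back, the kink of \<open>p\<close> at \<open>F t\<close>. The latter is divided by
  \<open>(r t)\<^sup>2\<close> because \<open>circ (F t)\<close> is \<open>T a b (circ t)\<close>
  shortened by the factor \<open>r t\<close>. The equation for \<open>\<kappa>\<close> thus says
  that \<open>T\<close> preserves the bent structure.\<close>

lemma kink_at_pull:
  assumes kink: "kink_at \<kappa> p (F t)" and \<kappa>: "\<kappa> t = T_kink t + \<kappa> (F t) / (r t)\<^sup>2"
  shows "kink_at \<kappa> (pull p) t"
proof -
  obtain q where r: "\<forall>\<^sub>F s in at_right (F t). p s = p (F t)"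
    and l: "\<forall>\<^sub>F s in at_left (F t). p s = q"
    and q: "p (F t) = shear (\<kappa> (F t)) (circ (F t)) q"
    using kink unfolding kink_at_def by auto
  have "\<forall>\<^sub>F s in at_right t. pull p s = pull p t"
    using coeff_const(1) eventually_compose_filterlim[OF r F_at_right]
    by eventually_elim (simp add: pull_def)
  moreover have "\<forall>\<^sub>F s in at_left t. pull p s = linTinv (left_coeff t) q"
    using coeff_const(2) eventually_compose_filterlim[OF l F_at_left]
    by eventually_elim (simp add: pull_def)
  moreover have "pull p t = shear (\<kappa> t) (circ t) (linTinv (left_coeff t) q)"
  proof -
    have "circ (F t) = (1 / r t) *\<^sub>R linT (left_coeff t) (circ t)"
      using r_pos[of t] by (simp add: linT_left T_circ)
    then have "p (F t) = shear (\<kappa> (F t) / (r t)\<^sup>2) (linT (left_coeff t) (circ t)) q"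
      by (simp add: q shear_scaleR power_divide)
    then show ?thesis
      by (simp add: pull_def linTinv_right_left linTinv_shear shear_shear \<kappa>)
  qed
  ultimately show ?thesis unfolding kink_at_def by (intro conjI exI)
qed

end

section \<open>Kinks along the half turn, and the action on solutions\<close>

locale half_turn_lift = circle_lift +
  fixes z :: "real \<times> real" and N :: nat
  assumes z: "z = (0, 1) \<or> z = (0, -1)" and half_turn: "(T a b ^^ N) z = - z"
begin

text \<open>The strength, with respect to the unit vector \<open>circ t\<close>, of a unit shear
  along \<open>(T a b ^^ i) z\<close>; hence the squared length, see
  \<open>shear_scaleR\<close>.\<close>

definition ray_mass :: "nat \<Rightarrow> real \<Rightarrow> real" where
  "ray_mass i t = (if circ t = sgn ((T a b ^^ i) z) then (norm ((T a b ^^ i) z))\<^sup>2 else 0)"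

text \<open>The sign makes the term \<open>i = N\<close>, on the ray of \<open>- z\<close>, equal to
  \<open>T_kink\<close> there. The sum starts at 1, so that the kink of \<open>T\<close> at
  \<open>z\<close> comes out as the missing term \<open>i = 0\<close>.\<close>

definition kinks :: "real \<Rightarrow> real" where
  "kinks t = (if z = (0, 1) then a - b else b - a) * (\<Sum>i=1..N. ray_mass i t)"

lemma ray_mass_F: "ray_mass (Suc i) (F t) = (r t)\<^sup>2 * ray_mass i t"
proof -
  define v where "v = (T a b ^^ i) z"
  have v: "norm v > 0" using z by (auto simp: v_def) (auto simp: zero_prod_def)
  then have v': "v = norm v *\<^sub>R sgn v" by (simp add: sgn_div_norm)
  have S: "S a b (sgn v) = sgn (T a b v)"
    using v by (simp add: S_eq_sgn sgn_div_norm T_scaleR)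
  have iff: "circ (F t) = sgn (T a b v) \<longleftrightarrow> circ t = sgn v"
    unfolding S[symmetric] lift[symmetric] using inj_on_S[of a b] v by (auto simp: inj_on_def norm_sgn)
  have "norm (T a b v) = norm v * r t" if "circ t = sgn v"
  proof -
    have "T a b v = T a b (norm v *\<^sub>R circ t)" using v' that by simp
    also have "\<dots> = norm v *\<^sub>R T a b (circ t)" by (rule T_scaleR) simp
    finally show ?thesis by (simp add: r_def)
  qed
  then show ?thesis
    using iff by (simp add: ray_mass_def power_mult_distrib flip: v_def)
qed

text \<open>The sum over \<open>i = 1..N\<close> telescopes; what is left over at \<open>i = 0\<close> and \<open>i = N\<close>, the rays of
  \<open>z\<close> and \<open>- z\<close>, are exactly the two kinks of \<open>T\<close>.\<close>

lemma kinks_F: "kinks t = T_kink t + kinks (F t) / (r t)\<^sup>2"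
proof -
  define s where "s = (if z = (0, 1) then a - b else b - a)"
  have "(\<Sum>i=1..N. ray_mass i (F t)) = (\<Sum>i<N. ray_mass (Suc i) (F t))"
    by (simp add: sum.atLeast1_atMost_eq)
  also have "\<dots> = (r t)\<^sup>2 * (\<Sum>i<N. ray_mass i t)"
    by (simp add: ray_mass_F sum_distrib_left)
  finally have "kinks (F t) / (r t)\<^sup>2 = s * (\<Sum>i<N. ray_mass i t)"
    using r_pos[of t] by (simp add: kinks_def s_def)
  moreover have "(\<Sum>i=1..N. ray_mass i t) - (\<Sum>i<N. ray_mass i t) = ray_mass N t - ray_mass 0 t"
    using sum_lessThan_telescope[of "\<lambda>i. ray_mass i t" N]
    by (simp add: sum.atLeast1_atMost_eq sum_subtractf)
  then have "kinks t = s * (\<Sum>i<N. ray_mass i t) + s * (ray_mass N t - ray_mass 0 t)"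
    by (simp add: kinks_def s_def[symmetric] flip: distrib_left)
  moreover have "s * (ray_mass N t - ray_mass 0 t) = T_kink t"
  proof -
    have sgn: "sgn (0, 1 :: real) = (0 :: real, 1)" "sgn (0, - 1 :: real) = (0 :: real, -1)"
      by (simp_all add: sgn_div_norm norm_Pair)
    have "ray_mass 0 t = (if circ t = sgn z then (norm z)\<^sup>2 else 0)"
      "ray_mass N t = (if circ t = sgn (- z) then (norm z)\<^sup>2 else 0)"
      by (simp_all add: ray_mass_def half_turn)
    then show ?thesis using z by (elim disjE) (simp_all add: s_def sgn T_kink_def norm_Pair)
  qed
  ultimately show ?thesis by simp
qed

lemma kinks_add_1: "kinks (t + 1) = kinks t"
  by (simp add: kinks_def ray_mass_def)

lemma finite_kinks: "finite {t. \<bar>t\<bar> < real n \<and> kinks t \<noteq> 0}"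
proof (rule finite_subset)
  show "{t. \<bar>t\<bar> < real n \<and> kinks t \<noteq> 0} \<subseteq> (\<Union>i\<in>{1..N}. {t. \<bar>t\<bar> < real n \<and> circ t = sgn ((T a b ^^ i) z)})"
  proof
    fix t assume t: "t \<in> {t. \<bar>t\<bar> < real n \<and> kinks t \<noteq> 0}"
    then have "(\<Sum>i=1..N. ray_mass i t) \<noteq> 0" by (simp add: kinks_def)
    then obtain i where "i \<in> {1..N}" "ray_mass i t \<noteq> 0" by (rule sum.not_neutral_contains_not_neutral)
    then show "t \<in> (\<Union>i\<in>{1..N}. {t. \<bar>t\<bar> < real n \<and> circ t = sgn ((T a b ^^ i) z)})"
      using t by (auto simp: ray_mass_def split: if_splits)
  qed
  have "finite {t. \<bar>t\<bar> < real n \<and> circ t = u}" for u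
  proof (cases "\<exists>t0. circ t0 = u")
    case True
    then obtain t0 where u: "u = circ t0" by auto
    have "{t. \<bar>t\<bar> < real n \<and> circ t = u} \<subseteq> (\<lambda>m. t0 + of_int m) ` {- \<lceil>real n + \<bar>t0\<bar>\<rceil>..\<lceil>real n + \<bar>t0\<bar>\<rceil>}"
    proof
      fix t assume t: "t \<in> {t. \<bar>t\<bar> < real n \<and> circ t = u}"
      then obtain m :: int where m: "t = t0 + of_int m" unfolding u circ_eq_iff by auto
      then have "m \<in> {- \<lceil>real n + \<bar>t0\<bar>\<rceil>..\<lceil>real n + \<bar>t0\<bar>\<rceil>}" using t by (simp; linarith)
      then show "t \<in> (\<lambda>m. t0 + of_int m) ` {- \<lceil>real n + \<bar>t0\<bar>\<rceil>..\<lceil>real n + \<bar>t0\<bar>\<rceil>}" using m by blast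
    qed
    then show ?thesis by (rule finite_subset) simp
  qed auto
  then show "finite (\<Union>i\<in>{1..N}. {t. \<bar>t\<bar> < real n \<and> circ t = sgn ((T a b ^^ i) z)})" by simp
qed

lemma solves_pull: "solves kinks p \<Longrightarrow> solves kinks (pull p)"
  unfolding solves_def using kink_at_pull kinks_F by blast

lemma solves_shift:
  assumes "solves kinks p"
  shows "solves kinks (\<lambda>t. p (t + 1))"
  unfolding solves_def
proof
  fix t
  have "kink_at kinks p (t + 1)" using assms by (simp add: solves_def)
  then obtain q where q: "\<forall>\<^sub>F s in at_right (t + 1). p s = p (t + 1)" "\<forall>\<^sub>F s in at_left (t + 1). p s = q"
      "p (t + 1) = shear (kinks (t + 1)) (circ (t + 1)) q"
    unfolding kink_at_def by blast
  show "kink_at kinks (\<lambda>t. p (t + 1)) t"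
    unfolding kink_at_def
  proof (intro conjI exI)
    have lim: "((\<lambda>s. s + 1) \<longlongrightarrow> t + 1) (at t within A)" for A by (intro tendsto_intros)
    show "\<forall>\<^sub>F s in at_right t. p (s + 1) = p (t + 1)"
      by (rule eventually_compose_filterlim[OF q(1)])
        (use lim in \<open>auto simp: filterlim_at eventually_at_filter\<close>)
    show "\<forall>\<^sub>F s in at_left t. p (s + 1) = q"
      by (rule eventually_compose_filterlim[OF q(2)])
        (use lim in \<open>auto simp: filterlim_at eventually_at_filter\<close>)
    show "p (t + 1) = shear (kinks t) (circ t) q" using q(3) by (simp add: kinks_add_1)
  qed
qed

text \<open>A solution is determined by its value at \<open>0\<close>, so solutions form a plane on
  which \<open>pull\<close> and translation by 1 act by matrices A and H. Both preserve
  \<open>wedge\<close>, hence have determinant 1, and they commute by \<open>pull_add_1\<close>. The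
  last three equations are the entries of AH = HA; its two diagonal entries say the same.\<close>

lemma solution_basis:
  obtains p1 p2 a11 a12 a21 a22 h11 h12 h21 h22 where
    "solves kinks p1" "solves kinks p2" "\<And>t. wedge (p1 t) (p2 t) = 1"
    "\<And>t. pull p1 t = a11 *\<^sub>R p1 t + a12 *\<^sub>R p2 t" "\<And>t. pull p2 t = a21 *\<^sub>R p1 t + a22 *\<^sub>R p2 t"
    "\<And>t. p1 (t + 1) = h11 *\<^sub>R p1 t + h12 *\<^sub>R p2 t" "\<And>t. p2 (t + 1) = h21 *\<^sub>R p1 t + h22 *\<^sub>R p2 t"
    "a11 * a22 - a12 * a21 = 1" "h11 * h22 - h12 * h21 = 1"
    "a12 * h21 = h12 * a21" "a11 * h12 + a12 * h22 = h11 * a12 + h12 * a22"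
    "a21 * h11 + a22 * h21 = h21 * a11 + h22 * a21"
proof -
  obtain p1 where p1: "solves kinks p1" "p1 0 = (1, 0)"
    using solves_exists[OF finite_kinks, of "(1, 0)"] by blast
  obtain p2 where p2: "solves kinks p2" "p2 0 = (0, 1)"
    using solves_exists[OF finite_kinks, of "(0, 1)"] by blast
  have w: "wedge (p1 t) (p2 t) = 1" for t
    using solves_wedge_const[OF p1(1) p2(1), of t] p1 p2 by (simp add: wedge_def)
  have decomp: "p t = fst (p 0) *\<^sub>R p1 t + snd (p 0) *\<^sub>R p2 t" if "solves kinks p" for p t
  proof -
    have "p = (\<lambda>t. fst (p 0) *\<^sub>R p1 t + snd (p 0) *\<^sub>R p2 t)"
      by (rule solves_unique[OF that solves_linear[OF p1(1) p2(1)]]) (simp add: p1 p2)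
    then show ?thesis by metis
  qed
  define a11 a12 a21 a22 where defs: "a11 = fst (pull p1 0)" "a12 = snd (pull p1 0)"
    "a21 = fst (pull p2 0)" "a22 = snd (pull p2 0)"
  define h11 h12 h21 h22 where defsH: "h11 = fst (p1 1)" "h12 = snd (p1 1)"
    "h21 = fst (p2 1)" "h22 = snd (p2 1)"
  have A: "pull p1 t = a11 *\<^sub>R p1 t + a12 *\<^sub>R p2 t" "pull p2 t = a21 *\<^sub>R p1 t + a22 *\<^sub>R p2 t" for t
    unfolding defs by (intro decomp solves_pull p1 p2)+
  have H: "p1 (t + 1) = h11 *\<^sub>R p1 t + h12 *\<^sub>R p2 t" "p2 (t + 1) = h21 *\<^sub>R p1 t + h22 *\<^sub>R p2 t" for t
    using decomp[OF solves_shift[OF p1(1)], of t] decomp[OF solves_shift[OF p2(1)], of t]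
    by (simp_all add: defsH)
  have "wedge (pull p1 0) (pull p2 0) = 1" by (simp add: pull_def w)
  then have detA: "a11 * a22 - a12 * a21 = 1" by (simp add: wedge_def defs)
  have detH: "h11 * h22 - h12 * h21 = 1" using w[of 1] by (simp add: wedge_def defsH)
  have shifted: "(\<lambda>t. p1 (t + 1)) = (\<lambda>t. h11 *\<^sub>R p1 t + h12 *\<^sub>R p2 t)"
    "(\<lambda>t. p2 (t + 1)) = (\<lambda>t. h21 *\<^sub>R p1 t + h22 *\<^sub>R p2 t)"
    using H by auto
  have "pull p1 (0 + 1) = h11 *\<^sub>R pull p1 0 + h12 *\<^sub>R pull p2 0"
    "pull p2 (0 + 1) = h21 *\<^sub>R pull p1 0 + h22 *\<^sub>R pull p2 0"
    unfolding pull_add_1[symmetric] shifted pull_linear by simp_all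
  then have "a11 *\<^sub>R p1 1 + a12 *\<^sub>R p2 1 = h11 *\<^sub>R pull p1 0 + h12 *\<^sub>R pull p2 0"
    "a21 *\<^sub>R p1 1 + a22 *\<^sub>R p2 1 = h21 *\<^sub>R pull p1 0 + h22 *\<^sub>R pull p2 0"
    by (simp_all add: A)
  then have comm: "a12 * h21 = h12 * a21" "a11 * h12 + a12 * h22 = h11 * a12 + h12 * a22"
    "a21 * h11 + a22 * h21 = h21 * a11 + h22 * a21"
    by (simp_all add: defs defsH prod_eq_iff algebra_simps)
  show ?thesis by (rule that[OF p1(1) p2(1) w A H detA detH comm])
qed

end

section \<open>The invariant quadratic form\<close>

definition qform :: "real \<Rightarrow> real \<Rightarrow> real \<Rightarrow> real \<Rightarrow> real \<Rightarrow> real" where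
  "qform \<alpha> \<beta> \<gamma> x y = \<alpha> * x\<^sup>2 + \<beta> * x * y + \<gamma> * y\<^sup>2"

text \<open>The form is \<open>w \<mapsto> w \<and> M w\<close>: since \<open>L\<close> commutes with \<open>M\<close>, \<open>L w \<and> M L w = L w \<and> L M w = det L (w \<and> M w)\<close>.\<close>

lemma qform_commuting:
  fixes m11 m12 m21 m22 l11 l12 l21 l22 :: real
  assumes "m12 * l21 = l12 * m21" "m11 * l12 + m12 * l22 = l11 * m12 + l12 * m22"
    "m21 * l11 + m22 * l21 = l21 * m11 + l22 * m21" "l11 * l22 - l12 * l21 = 1"
  shows "qform m21 (m22 - m11) (- m12) (l11 * x + l12 * y) (l21 * x + l22 * y)
    = qform m21 (m22 - m11) (- m12) x y"
proof -
  define X Y U V where "X = l11 * x + l12 * y" and "Y = l21 * x + l22 * y"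
    and "U = m11 * x + m12 * y" and "V = m21 * x + m22 * y"
  have "m21 * X + m22 * Y = (m21 * l11 + m22 * l21) * x + (m21 * l12 + m22 * l22) * y"
    by (simp add: X_def Y_def algebra_simps)
  also have "\<dots> = l21 * U + l22 * V"
    unfolding assms(3) using assms(1) by (simp add: U_def V_def algebra_simps)
  finally have 1: "m21 * X + m22 * Y = l21 * U + l22 * V" .
  have "m11 * X + m12 * Y = (m11 * l11 + m12 * l21) * x + (m11 * l12 + m12 * l22) * y"
    by (simp add: X_def Y_def algebra_simps)
  also have "\<dots> = l11 * U + l12 * V"
    unfolding assms(1,2) by (simp add: U_def V_def algebra_simps)
  finally have 2: "m11 * X + m12 * Y = l11 * U + l12 * V" .
  have "qform m21 (m22 - m11) (- m12) X Y = X * (m21 * X + m22 * Y) - Y * (m11 * X + m12 * Y)"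
    by (simp add: qform_def power2_eq_square algebra_simps)
  also have "\<dots> = (l11 * l22 - l12 * l21) * (x * V - y * U)"
    unfolding 1 2 by (simp add: X_def Y_def algebra_simps)
  also have "\<dots> = qform m21 (m22 - m11) (- m12) x y"
    unfolding assms(4) by (simp add: U_def V_def qform_def power2_eq_square algebra_simps)
  finally show ?thesis by (simp add: X_def Y_def)
qed

text \<open>The matrix M of \<open>qform_commuting\<close> is taken to be A or H, whichever is not a
  multiple of the identity, since for a multiple the form vanishes. If both are multiples, they are
  the identity up to sign and any form is invariant.\<close>

lemma invariant_qform:
  fixes a11 a12 a21 a22 h11 h12 h21 h22 :: real
  assumes detA: "a11 * a22 - a12 * a21 = 1" and detH: "h11 * h22 - h12 * h21 = 1"
    and comm: "a12 * h21 = h12 * a21" "a11 * h12 + a12 * h22 = h11 * a12 + h12 * a22"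
      "a21 * h11 + a22 * h21 = h21 * a11 + h22 * a21"
  obtains \<alpha> \<beta> \<gamma> where "\<alpha> \<noteq> 0 \<or> \<beta> \<noteq> 0 \<or> \<gamma> \<noteq> 0"
    "\<And>x y. qform \<alpha> \<beta> \<gamma> (a11 * x + a12 * y) (a21 * x + a22 * y) = qform \<alpha> \<beta> \<gamma> x y"
    "\<And>x y. qform \<alpha> \<beta> \<gamma> (h11 * x + h12 * y) (h21 * x + h22 * y) = qform \<alpha> \<beta> \<gamma> x y"
proof -
  consider "a21 \<noteq> 0 \<or> a22 - a11 \<noteq> 0 \<or> - a12 \<noteq> 0" | "h21 \<noteq> 0 \<or> h22 - h11 \<noteq> 0 \<or> - h12 \<noteq> 0"
    | "a21 = 0" "a22 = a11" "a12 = 0" "h21 = 0" "h22 = h11" "h12 = 0"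
    by fastforce
  then show ?thesis
  proof cases
    case 1
    show ?thesis
      by (rule that[OF 1 qform_commuting[OF refl refl refl detA] qform_commuting[OF comm detH]])
  next
    case 2
    show ?thesis
      by (rule that[OF 2 qform_commuting[OF comm[symmetric] detA] qform_commuting[OF refl refl refl detH]])
  next
    case 3
    have "a11\<^sup>2 = 1" "h11\<^sup>2 = 1" using detA detH 3 by (simp_all add: power2_eq_square)
    then show ?thesis
      by (intro that[of 1 0 1]) (simp_all add: 3 qform_def power_mult_distrib)
  qed
qed

lemma qform_minus: "qform (- \<alpha>) (- \<beta>) (- \<gamma>) x y = - qform \<alpha> \<beta> \<gamma> x y"
  by (simp add: qform_def)

lemma qform_scale: "qform \<alpha> \<beta> \<gamma> (c * x) (c * y) = c\<^sup>2 * qform \<alpha> \<beta> \<gamma> x y"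
  by (simp add: qform_def power2_eq_square algebra_simps)

lemma qform_comb:
  "qform \<alpha> \<beta> \<gamma> (x0 * c + x1 * d) (y0 * c + y1 * d) =
     qform (qform \<alpha> \<beta> \<gamma> x0 y0) (2 * \<alpha> * x0 * x1 + \<beta> * (x0 * y1 + x1 * y0) + 2 * \<gamma> * y0 * y1)
       (qform \<alpha> \<beta> \<gamma> x1 y1) c d"
  by (simp add: qform_def power2_eq_square algebra_simps)

lemma qform_eq_0:
  assumes "\<And>x y. qform \<alpha> \<beta> \<gamma> x y = 0"
  shows "\<alpha> = 0 \<and> \<beta> = 0 \<and> \<gamma> = 0"
  using assms[of 1 0] assms[of 0 1] assms[of 1 1] by (simp add: qform_def)

lemma wedge_expand:
  assumes "wedge u v = 1"
  shows "w = wedge u w *\<^sub>R v - wedge v w *\<^sub>R u"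
proof -
  have "wedge u w *\<^sub>R v - wedge v w *\<^sub>R u = wedge u v *\<^sub>R w"
    by (cases u; cases v; cases w) (simp add: wedge_def algebra_simps)
  then show ?thesis using assms by simp
qed

text \<open>In the basis \<open>circ t\<close>, \<open>e\<close> the direction \<open>circ s\<close>
  has coordinates \<open>C s\<close>, tending to 1, and \<open>D s\<close>, tending to 0 but nonzero
  near \<open>t\<close>. The first nonzero coefficient among \<open>P\<close>, \<open>R\<close>,
  \<open>W\<close> therefore dominates; one exists because the change of coordinates has determinant
  1.\<close>

lemma qform_circ_isolated_zeros:
  assumes uv: "wedge u v = 1" and nz: "\<alpha> \<noteq> 0 \<or> \<beta> \<noteq> 0 \<or> \<gamma> \<noteq> 0"
  shows "\<forall>\<^sub>F s in at t. qform \<alpha> \<beta> \<gamma> (wedge u (circ s)) (wedge v (circ s)) \<noteq> 0"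
proof -
  define e where "e = (- snd (circ t), fst (circ t))"
  define C D where "C s = cos (2 * pi * (s - t))" and "D s = sin (2 * pi * (s - t))" for s
  have circ: "circ s = C s *\<^sub>R circ t + D s *\<^sub>R e" for s
  proof -
    have "2 * pi * s = 2 * pi * (s - t) + 2 * pi * t" by (simp add: algebra_simps)
    then have "circ s = (cos (2 * pi * (s - t) + 2 * pi * t), sin (2 * pi * (s - t) + 2 * pi * t))"
      by (simp only: circ_def)
    then show ?thesis unfolding cos_add sin_add by (simp add: C_def D_def e_def circ_def)
  qed
  define x0 x1 y0 y1 where "x0 = wedge u (circ t)" and "x1 = wedge u e"
    and "y0 = wedge v (circ t)" and "y1 = wedge v e"
  have "x0 * y1 - x1 * y0 = wedge u v * wedge (circ t) e"
    by (simp add: x0_def x1_def y0_def y1_def wedge_def algebra_simps)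
  also have "\<dots> = 1" using uv sin_cos_squared_add[of "2 * pi * t"]
    by (simp add: wedge_def e_def circ_def power2_eq_square)
  finally have det: "x0 * y1 - x1 * y0 = 1" .
  define P R W where "P = qform \<alpha> \<beta> \<gamma> x0 y0"
    and "R = 2 * \<alpha> * x0 * x1 + \<beta> * (x0 * y1 + x1 * y0) + 2 * \<gamma> * y0 * y1"
    and "W = qform \<alpha> \<beta> \<gamma> x1 y1"
  have comb: "qform \<alpha> \<beta> \<gamma> (x0 * c + x1 * d) (y0 * c + y1 * d) = qform P R W c d" for c d
    unfolding P_def R_def W_def by (rule qform_comb)
  have q: "qform \<alpha> \<beta> \<gamma> (wedge u (circ s)) (wedge v (circ s)) = qform P R W (C s) (D s)" for s
    unfolding comb[symmetric] circ[of s] x0_def x1_def y0_def y1_def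
    by (simp add: wedge_simps mult.commute)
  have nz': "P \<noteq> 0 \<or> R \<noteq> 0 \<or> W \<noteq> 0"
  proof (rule ccontr)
    assume "\<not> ?thesis"
    then have zero: "qform \<alpha> \<beta> \<gamma> (x0 * c + x1 * d) (y0 * c + y1 * d) = 0" for c d
      unfolding comb by (simp add: qform_def)
    have xy: "x0 * (y1 * x - x1 * y) + x1 * (x0 * y - y0 * x) = x"
      "y0 * (y1 * x - x1 * y) + y1 * (x0 * y - y0 * x) = y" for x y
    proof -
      have "x0 * (y1 * x - x1 * y) + x1 * (x0 * y - y0 * x) = (x0 * y1 - x1 * y0) * x"
        "y0 * (y1 * x - x1 * y) + y1 * (x0 * y - y0 * x) = (x0 * y1 - x1 * y0) * y"
        by (simp_all add: algebra_simps)
      then show "x0 * (y1 * x - x1 * y) + x1 * (x0 * y - y0 * x) = x"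
        "y0 * (y1 * x - x1 * y) + y1 * (x0 * y - y0 * x) = y" unfolding det by simp_all
    qed
    have "qform \<alpha> \<beta> \<gamma> x y = 0" for x y
      using zero[of "y1 * x - x1 * y" "x0 * y - y0 * x"] unfolding xy .
    then show False using qform_eq_0 nz by blast
  qed
  have lim: "(C \<longlongrightarrow> 1) (at t)" "(D \<longlongrightarrow> 0) (at t)"
  proof -
    have "(C \<longlongrightarrow> cos (2 * pi * (t - t))) (at t)" "(D \<longlongrightarrow> sin (2 * pi * (t - t))) (at t)"
      unfolding C_def D_def by (intro tendsto_intros)+
    then show "(C \<longlongrightarrow> 1) (at t)" "(D \<longlongrightarrow> 0) (at t)" by simp_all
  qed
  have "\<forall>\<^sub>F s in at t. qform P R W (C s) (D s) \<noteq> 0"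
  proof (cases "P = 0")
    case False
    have "((\<lambda>s. qform P R W (C s) (D s)) \<longlongrightarrow> qform P R W 1 0) (at t)"
      unfolding qform_def by (intro tendsto_intros lim)
    then show ?thesis using False by (intro tendsto_imp_eventually_ne) (auto simp: qform_def)
  next
    case True
    have D: "\<forall>\<^sub>F s in at t. D s \<noteq> 0"
      unfolding D_def eventually_at_split
      using eventually_sin_pos[of t] eventually_sin_neg[of t] by (auto elim: eventually_mono)
    have q: "qform P R W (C s) (D s) = D s * (R * C s + W * D s)" for s
      by (simp add: True qform_def power2_eq_square algebra_simps)
    have "\<forall>\<^sub>F s in at t. R * C s + W * D s \<noteq> 0"
    proof (cases "R = 0")
      case False
      have "((\<lambda>s. R * C s + W * D s) \<longlongrightarrow> R * 1 + W * 0) (at t)"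
        by (intro tendsto_intros lim)
      then show ?thesis using False by (intro tendsto_imp_eventually_ne) auto
    next
      case R: True
      show ?thesis using D by eventually_elim (use True R nz' in simp)
    qed
    with D show ?thesis by eventually_elim (simp add: q)
  qed
  then show ?thesis unfolding q .
qed

section \<open>The form in bent coordinates\<close>

locale bent_form = circle_lift +
  fixes \<kappa> :: "real \<Rightarrow> real" and p1 p2 :: "real \<Rightarrow> real \<times> real"
    and a11 a12 a21 a22 h11 h12 h21 h22 \<alpha> \<beta> \<gamma> :: real
  assumes p1: "solves \<kappa> p1" and p2: "solves \<kappa> p2" and wedge_p: "wedge (p1 t) (p2 t) = 1"
    and pull_p1: "pull p1 t = a11 *\<^sub>R p1 t + a12 *\<^sub>R p2 t"
    and pull_p2: "pull p2 t = a21 *\<^sub>R p1 t + a22 *\<^sub>R p2 t"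
    and shift_p1: "p1 (t + 1) = h11 *\<^sub>R p1 t + h12 *\<^sub>R p2 t"
    and shift_p2: "p2 (t + 1) = h21 *\<^sub>R p1 t + h22 *\<^sub>R p2 t"
    and detA: "a11 * a22 - a12 * a21 = 1" and detH: "h11 * h22 - h12 * h21 = 1"
    and form_nz: "\<alpha> \<noteq> 0 \<or> \<beta> \<noteq> 0 \<or> \<gamma> \<noteq> 0"
    and form_A: "qform \<alpha> \<beta> \<gamma> (a11 * x + a12 * y) (a21 * x + a22 * y) = qform \<alpha> \<beta> \<gamma> x y"
    and form_H: "qform \<alpha> \<beta> \<gamma> (h11 * x + h12 * y) (h21 * x + h22 * y) = qform \<alpha> \<beta> \<gamma> x y"
begin

text \<open>The pair \<open>(f1 t, f2 t)\<close> is the developing map of the bent structure: the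
  coordinates of \<open>circ t\<close> in which \<open>T\<close> acts by A and a full turn by H. On
  the plane, the invariant function is the squared norm times \<open>Q\<close> of the angle.\<close>

definition f1 :: "real \<Rightarrow> real" where "f1 t = wedge (p1 t) (circ t)"
definition f2 :: "real \<Rightarrow> real" where "f2 t = wedge (p2 t) (circ t)"
definition Q :: "real \<Rightarrow> real" where "Q t = qform \<alpha> \<beta> \<gamma> (f1 t) (f2 t)"

lemma f_F: "r t * f1 (F t) = a11 * f1 t + a12 * f2 t" "r t * f2 (F t) = a21 * f1 t + a22 * f2 t"
  using wedge_pull[of p1 t] wedge_pull[of p2 t]
  by (simp_all add: f1_def f2_def pull_p1 pull_p2 wedge_simps)

lemma f_shift: "f1 (t + 1) = h11 * f1 t + h12 * f2 t" "f2 (t + 1) = h21 * f1 t + h22 * f2 t"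
  by (simp_all add: f1_def f2_def shift_p1 shift_p2 wedge_simps)

lemma continuous_f: "continuous_on A f1" "continuous_on A f2"
  unfolding f1_def f2_def by (intro solution_continuous[OF p1] solution_continuous[OF p2])+

lemma continuous_Q: "continuous_on A Q"
  unfolding Q_def qform_def by (intro continuous_intros continuous_f)

lemma Q_F: "(r t)\<^sup>2 * Q (F t) = Q t"
  unfolding Q_def qform_scale[symmetric] f_F form_A ..

lemma Q_shift: "Q (t + 1) = Q t"
  unfolding Q_def f_shift form_H ..

lemma Q_add_int: "Q (t + of_int m) = Q t"
proof (induction m rule: int_induct[where k = 0])
  case (step1 i)
  then show ?case using Q_shift[of "t + of_int i"] by (simp add: add.assoc)
next
  case (step2 i)
  then show ?case using Q_shift[of "t + of_int (i - 1)"] by (simp add: algebra_simps)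
qed simp

lemma f_right:
  "\<forall>\<^sub>F s in at_right t. f1 s = wedge (p1 t) (circ s) \<and> f2 s = wedge (p2 t) (circ s)"
proof -
  have "\<forall>\<^sub>F s in at_right t. p1 s = p1 t" "\<forall>\<^sub>F s in at_right t. p2 s = p2 t"
    using p1 p2 by (simp_all add: solves_def kink_at_def)
  then show ?thesis by eventually_elim (simp add: f1_def f2_def)
qed

text \<open>The left values \<open>u\<close>, \<open>v\<close> of the solutions give the coordinates
  at \<open>t\<close> as well, since the shear there fixes \<open>circ t\<close>. Each closed side
  of \<open>t\<close> thus has one linear formula.\<close>

lemma f_left:
  obtains u v where "wedge u v = 1" "f1 t = wedge u (circ t)" "f2 t = wedge v (circ t)"
    "\<forall>\<^sub>F s in at_left t. f1 s = wedge u (circ s) \<and> f2 s = wedge v (circ s)"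
proof -
  have "kink_at \<kappa> p1 t" "kink_at \<kappa> p2 t" using p1 p2 by (simp_all add: solves_def)
  then obtain u v where ev: "\<forall>\<^sub>F s in at_left t. p1 s = u" "\<forall>\<^sub>F s in at_left t. p2 s = v"
    and uv: "p1 t = shear (\<kappa> t) (circ t) u" "p2 t = shear (\<kappa> t) (circ t) v"
    unfolding kink_at_def by blast
  have "wedge u v = 1" using wedge_p[of t] by (simp add: uv)
  moreover have "\<forall>\<^sub>F s in at_left t. f1 s = wedge u (circ s) \<and> f2 s = wedge v (circ s)"
    using ev by eventually_elim (simp add: f1_def f2_def)
  ultimately show ?thesis by (intro that[of u v]) (simp_all add: f1_def f2_def uv)
qed

lemma Q_isolated_zeros: "\<forall>\<^sub>F s in at t. Q s \<noteq> 0"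
  unfolding eventually_at_split
proof
  obtain u v where uv: "wedge u v = 1"
    and ev: "\<forall>\<^sub>F s in at_left t. f1 s = wedge u (circ s) \<and> f2 s = wedge v (circ s)"
    by (rule f_left[of t])
  have "\<forall>\<^sub>F s in at_left t. qform \<alpha> \<beta> \<gamma> (wedge u (circ s)) (wedge v (circ s)) \<noteq> 0"
    using qform_circ_isolated_zeros[OF uv form_nz] by (simp add: eventually_at_split)
  with ev show "\<forall>\<^sub>F s in at_left t. Q s \<noteq> 0" by eventually_elim (simp add: Q_def)
  have "\<forall>\<^sub>F s in at_right t. qform \<alpha> \<beta> \<gamma> (wedge (p1 t) (circ s)) (wedge (p2 t) (circ s)) \<noteq> 0"
    using qform_circ_isolated_zeros[OF wedge_p form_nz] by (simp add: eventually_at_split)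
  with f_right show "\<forall>\<^sub>F s in at_right t. Q s \<noteq> 0" by eventually_elim (simp add: Q_def)
qed

text \<open>The zero set of \<open>Q\<close> is invariant under \<open>F\<close> and integer translations, so it would contain an
  orbit, which accumulates somewhere.\<close>

lemma Q_nonzero: "Q t \<noteq> 0"
proof
  assume Q: "Q t = 0"
  have Qn: "Q ((F ^^ n) t) = 0" for n
  proof (induction n)
    case (Suc n)
    then show ?case using Q_F[of "(F ^^ n) t"] r_pos[of "(F ^^ n) t"] by simp
  qed (simp add: Q)
  obtain x where x: "x islimpt {(F ^^ n) t + of_int m |n m. True}" using orbit_limit_point by blast
  have "\<forall>\<^sub>F s in at x. s \<notin> {(F ^^ n) t + of_int m |n m. True}"
    using Q_isolated_zeros by eventually_elim (auto simp: Q_add_int Qn)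
  then show False using x by (simp add: islimpt_iff_eventually)
qed

end

section \<open>The level curve and density of orbits on it\<close>

locale positive_bent_form = bent_form +
  assumes Q0: "Q 0 > 0"
begin

lemma Q_pos: "Q t > 0"
proof (rule ccontr)
  assume "\<not> Q t > 0"
  moreover have "is_interval (range Q)"
    using connected_continuous_image[OF continuous_Q connected_UNIV] by (simp add: is_interval_connected_1)
  ultimately have "0 \<in> range Q" using Q0 unfolding is_interval_1 by (meson not_less rangeI order_less_imp_le)
  then show False using Q_nonzero by auto
qed

text \<open>The polar parametrization of the level curve with value 1; the other level curves are
  its multiples.\<close>

definition g :: "real \<Rightarrow> real \<times> real" where
  "g t = (1 / sqrt (Q t)) *\<^sub>R circ t"

lemma g_nonzero [simp]: "g t \<noteq> 0"
  using Q_pos[of t] by (simp add: g_def)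

lemma continuous_g: "continuous_on A g"
  unfolding g_def by (intro continuous_intros continuous_Q) (use Q_pos in \<open>auto simp: less_imp_neq[symmetric]\<close>)

lemma g_add_int [simp]: "g (t + of_int m) = g t"
  by (simp add: g_def Q_add_int)

lemma circ_scaled_eq:
  assumes "c *\<^sub>R circ s = d *\<^sub>R circ t" "c > 0" "d > 0"
  shows "circ s = circ t"
proof -
  have "norm (c *\<^sub>R circ s) = norm (d *\<^sub>R circ t)" by (simp only: assms(1))
  then have "c = d" using assms(2,3) by simp
  then show ?thesis using assms by simp
qed

lemma g_eqD:
  assumes "g s = g t"
  shows "\<exists>m::int. s = t + of_int m"
  unfolding circ_eq_iff[symmetric]
  by (rule circ_scaled_eq[OF assms[unfolded g_def]]) (simp_all add: Q_pos)

lemma sqrt_Q_F: "sqrt (Q (F t)) = sqrt (Q t) / r t"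
proof -
  have "sqrt (Q t) = sqrt ((r t)\<^sup>2 * Q (F t))" by (simp only: Q_F)
  then show ?thesis using r_pos[of t] by (simp add: real_sqrt_mult)
qed

lemma T_g: "T a b (g t) = g (F t)"
proof -
  have "T a b (g t) = (1 / sqrt (Q t)) *\<^sub>R T a b (circ t)"
    unfolding g_def by (rule T_scaleR) (simp add: Q_pos less_imp_le)
  then show ?thesis using r_pos[of t] by (simp add: g_def T_circ sqrt_Q_F)
qed

lemma funpow_T_g: "(T a b ^^ n) (g t) = g ((F ^^ n) t)"
  by (induction n) (simp_all add: T_g)

definition h1 :: "real \<Rightarrow> real" where "h1 t = f1 t / sqrt (Q t)"
definition h2 :: "real \<Rightarrow> real" where "h2 t = f2 t / sqrt (Q t)"

lemma continuous_h: "continuous_on A h1" "continuous_on A h2"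
  unfolding h1_def h2_def
  by (intro continuous_intros continuous_f continuous_Q; use Q_pos in \<open>auto simp: less_imp_neq[symmetric]\<close>)+

lemma qform_h: "qform \<alpha> \<beta> \<gamma> (h1 t) (h2 t) = 1"
  using qform_scale[of \<alpha> \<beta> \<gamma> "1 / sqrt (Q t)" "f1 t" "f2 t"] Q_pos[of t]
  by (simp add: h1_def h2_def Q_def[symmetric] power_divide)

text \<open>The area form in bent coordinates, evaluated at two points of the level curve. The
  arguments are angles on the covering line: integer translations preserve it when applied to both,
  as H then acts on both points.\<close>

definition W :: "real \<Rightarrow> real \<Rightarrow> real" where
  "W s t = h1 s * h2 t - h2 s * h1 t"

lemma W_F: "W (F s) (F t) = W s t"
proof -
  have f: "f1 (F t) = (a11 * f1 t + a12 * f2 t) / r t" "f2 (F t) = (a21 * f1 t + a22 * f2 t) / r t" for t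
    using f_F[of t] r_pos[of t] by (simp_all add: field_simps)
  have h: "h1 (F t) = a11 * h1 t + a12 * h2 t" "h2 (F t) = a21 * h1 t + a22 * h2 t" for t
    using r_pos[of t] Q_pos[of t] by (simp_all add: h1_def h2_def sqrt_Q_F f flip: add_divide_distrib)
  have "W (F s) (F t) = (a11 * a22 - a12 * a21) * W s t"
    unfolding W_def h by (simp add: algebra_simps)
  then show ?thesis by (simp add: detA)
qed

lemma W_shift: "W (s + 1) (t + 1) = W s t"
proof -
  have h: "h1 (t + 1) = h11 * h1 t + h12 * h2 t" "h2 (t + 1) = h21 * h1 t + h22 * h2 t" for t
    by (simp_all add: h1_def h2_def Q_shift f_shift add_divide_distrib)
  have "W (s + 1) (t + 1) = (h11 * h22 - h12 * h21) * W s t"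
    unfolding W_def h by (simp add: algebra_simps)
  then show ?thesis by (simp add: detH)
qed

lemma W_funpow: "W ((F ^^ n) s) ((F ^^ n) t) = W s t"
  by (induction n) (simp_all add: W_F)

lemma W_add_int: "W (s + of_int m) (t + of_int m) = W s t"
proof (induction m rule: int_induct[where k = 0])
  case (step1 i)
  then show ?case using W_shift[of "s + of_int i" "t + of_int i"] by (simp add: add.assoc)
next
  case (step2 i)
  then show ?case using W_shift[of "s + of_int (i - 1)" "t + of_int (i - 1)"] by (simp add: algebra_simps)
qed simp

text \<open>Just to the right of \<open>t\<close> both points are described by the same
  \<open>p1 t\<close>, \<open>p2 t\<close>, so \<open>W\<close> is a positive multiple of the sine
  of the angle between them.\<close>

lemma W_right_nonzero: "\<forall>\<^sub>F s in at_right t. W t s \<noteq> 0"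
  using f_right[of t] eventually_sin_pos[of t]
proof eventually_elim
  case (elim s)
  have "f1 t * f2 s - f2 t * f1 s = wedge (p1 t) (p2 t) * wedge (circ t) (circ s)"
    using elim(1) by (simp add: f1_def f2_def) (simp add: wedge_def algebra_simps)
  then have "f1 t * f2 s - f2 t * f1 s > 0" using elim(2) by (simp add: wedge_p wedge_circ)
  moreover have "W t s = (f1 t * f2 s - f2 t * f1 s) / (sqrt (Q t) * sqrt (Q s))"
    by (simp add: W_def h1_def h2_def diff_divide_distrib)
  ultimately show ?case using Q_pos[of t] Q_pos[of s] by simp
qed

text \<open>\<open>W\<close> vanishes on the diagonal. A common integer translation brings
  \<open>x\<close> into the unit interval and \<open>y\<close> within distance 1 of it, so uniform
  continuity on one compact square gives a \<open>\<delta>\<close> valid on the whole line.\<close>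

lemma W_small:
  assumes "\<epsilon> > 0"
  obtains \<delta> where "\<delta> > 0" "\<And>x y. \<bar>x - y\<bar> < \<delta> \<Longrightarrow> \<bar>W x y\<bar> < \<epsilon>"
proof -
  have "continuous_on ({-1..2} \<times> {-1..2}) (\<lambda>z. W (fst z) (snd z))"
    unfolding W_def by (intro continuous_intros continuous_on_compose2[OF continuous_h(1)[of UNIV]]
        continuous_on_compose2[OF continuous_h(2)[of UNIV]]) auto
  then have "uniformly_continuous_on ({-1..2} \<times> {-1..2}) (\<lambda>z. W (fst z) (snd z))"
    by (intro compact_uniformly_continuous compact_Times compact_Icc)
  then obtain \<delta> where \<delta>: "\<delta> > 0" "\<And>z z'. z \<in> {-1..2} \<times> {-1..2} \<Longrightarrow> z' \<in> {-1..2} \<times> {-1..2} \<Longrightarrow>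
      dist z' z < \<delta> \<Longrightarrow> dist (W (fst z') (snd z')) (W (fst z) (snd z)) < \<epsilon>"
    using assms unfolding uniformly_continuous_on_def by blast
  have "\<bar>W x y\<bar> < \<epsilon>" if xy: "\<bar>x - y\<bar> < min \<delta> 1" for x y
  proof -
    define x' y' where "x' = x + of_int (- \<lfloor>x\<rfloor>)" and "y' = y + of_int (- \<lfloor>x\<rfloor>)"
    have "x' \<in> {-1..2}" "y' \<in> {-1..2}" using xy unfolding x'_def y'_def by (simp; linarith)+
    moreover have "dist (x', y') (x', x') < \<delta>" using xy by (simp add: dist_Pair_Pair dist_real_def x'_def y'_def abs_minus_commute)
    ultimately have "dist (W x' y') (W x' x') < \<epsilon>" using \<delta>(2)[of "(x', x')" "(x', y')"] by simp
    moreover have "W x' x' = 0" by (simp add: W_def)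
    moreover have "W x' y' = W x y" unfolding x'_def y'_def by (rule W_add_int)
    ultimately show ?thesis by (simp add: dist_real_def)
  qed
  then show ?thesis using that[of "min \<delta> 1"] \<delta>(1) by simp
qed

text \<open>The lifted two-sided orbit, written without an inverse of \<open>F\<close>:
  \<open>x\<close> belongs to it if forward iterates of \<open>x\<close> and \<open>t\<close> meet
  modulo 1.\<close>

definition full_orbit :: "real \<Rightarrow> real set" where
  "full_orbit t = {x. \<exists>n k. \<exists>m::int. (F ^^ n) x = (F ^^ k) t + of_int m}"

lemma F_full_orbit_iff: "F x \<in> full_orbit t \<longleftrightarrow> x \<in> full_orbit t"
proof
  assume "F x \<in> full_orbit t"
  then obtain n k and m :: int where "(F ^^ n) (F x) = (F ^^ k) t + of_int m" by (auto simp: full_orbit_def)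
  then have "(F ^^ Suc n) x = (F ^^ k) t + of_int m" by (simp add: funpow_swap1)
  then show "x \<in> full_orbit t" unfolding full_orbit_def by blast
next
  assume "x \<in> full_orbit t"
  then obtain n k and m :: int where "(F ^^ n) x = (F ^^ k) t + of_int m" by (auto simp: full_orbit_def)
  then have "(F ^^ n) (F x) = (F ^^ Suc k) t + of_int m" by (simp add: funpow_swap1[symmetric] F_add_int)
  then show "F x \<in> full_orbit t" unfolding full_orbit_def by blast
qed

lemma full_orbit_add_int: "x \<in> full_orbit t \<Longrightarrow> x + of_int m \<in> full_orbit t"
proof -
  assume "x \<in> full_orbit t"
  then obtain n k and l :: int where "(F ^^ n) x = (F ^^ k) t + of_int l" by (auto simp: full_orbit_def)
  then have "(F ^^ n) (x + of_int m) = (F ^^ k) t + of_int (l + m)" by (simp add: funpow_F_add_int)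
  then show ?thesis unfolding full_orbit_def by blast
qed

lemma funpow_full_orbit_iff: "(F ^^ n) x \<in> full_orbit t \<longleftrightarrow> x \<in> full_orbit t"
  by (induction n) (simp_all add: F_full_orbit_iff)

lemma closure_full_orbit_funpow:
  assumes "x \<in> closure (full_orbit t)"
  shows "(F ^^ n) x + of_int m \<in> closure (full_orbit t)"
proof -
  have cont_n: "continuous_on UNIV (F ^^ n)" for n
  proof (induction n)
    case (Suc n)
    then show ?case using continuous_on_compose2[OF cont Suc] by (simp add: o_def)
  qed (simp add: id_def)
  have "continuous_on (closure (full_orbit t)) (\<lambda>x. (F ^^ n) x + of_int m)"
    by (intro continuous_intros continuous_on_subset[OF cont_n]) simp
  then have "(\<lambda>x. (F ^^ n) x + of_int m) ` closure (full_orbit t) \<subseteq> closure (full_orbit t)"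
    by (rule image_closure_subset) (auto simp: full_orbit_add_int funpow_full_orbit_iff closure_subset[THEN subsetD])
  then show ?thesis using assms by blast
qed

text \<open>Two orbit points near a limit point \<open>x\<close>, at different distances from
  \<open>x\<close> so that they are distinct.\<close>

lemma orbit_close_pair:
  assumes "\<delta> > 0"
  obtains n k :: nat and m l :: int where
    "(F ^^ n) t + of_int m < (F ^^ k) t + of_int l" "(F ^^ k) t + of_int l < (F ^^ n) t + of_int m + \<delta>"
proof -
  obtain x where x: "x islimpt {(F ^^ n) t + of_int m |n m. True}" using orbit_limit_point by blast
  obtain y where y: "y \<in> {(F ^^ n) t + of_int m |n m. True}" "y \<noteq> x" "dist y x < \<delta> / 2"
    using x assms unfolding islimpt_approachable by (metis half_gt_zero)
  obtain y' where y': "y' \<in> {(F ^^ n) t + of_int m |n m. True}" "y' \<noteq> x" "dist y' x < dist y x"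
    using x y unfolding islimpt_approachable by (metis zero_less_dist_iff)
  have "dist y y' < \<delta>" using y(3) y'(3) dist_triangle2[of y y' x] by linarith
  moreover have "y \<noteq> y'" using y'(3) by auto
  ultimately have "y < y' \<and> y' < y + \<delta> \<or> y' < y \<and> y < y' + \<delta>" by (auto simp: dist_real_def)
  then show ?thesis using y(1) y'(1) that by blast
qed

text \<open>The images of a gap \<open>(\<alpha>', \<beta>')\<close> of the orbit closure are pairwise disjoint modulo 1, so they
  become arbitrarily short; this contradicts the invariance of \<open>W\<close>, which measures their size.\<close>

lemma full_orbit_dense: "closure (full_orbit t) = UNIV"
proof (rule ccontr)
  define E where "E = closure (full_orbit t)"
  assume "closure (full_orbit t) \<noteq> UNIV"
  then obtain y where y: "y \<notin> E" unfolding E_def by blast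
  have clE: "closed E" by (simp add: E_def)
  have "(F ^^ 0) t = (F ^^ 0) t + of_int 0" by simp
  then have "t \<in> full_orbit t" unfolding full_orbit_def by blast
  then have tE: "t + of_int m \<in> E" for m :: int
    using full_orbit_add_int closure_subset unfolding E_def by blast
  define \<alpha>' where "\<alpha>' = Sup (E \<inter> {..y})"
  have "t + of_int (- \<lceil>\<bar>t\<bar> + \<bar>y\<bar>\<rceil>) \<le> y" by (simp; linarith)
  then have neA: "E \<inter> {..y} \<noteq> {}" using tE by blast
  have bdA: "bdd_above (E \<inter> {..y})" by (auto simp: bdd_above_def)
  have "\<alpha>' \<in> E \<inter> {..y}" unfolding \<alpha>'_def
    by (rule closed_contains_Sup[OF neA bdA]) (simp add: clE closed_Int)
  then have \<alpha>': "\<alpha>' \<in> E" "\<alpha>' < y" using y by (auto simp: less_le)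
  define \<beta>' where "\<beta>' = Inf (E \<inter> {y..})"
  have "y \<le> t + of_int \<lceil>\<bar>t\<bar> + \<bar>y\<bar>\<rceil>" by linarith
  then have neB: "E \<inter> {y..} \<noteq> {}" using tE by blast
  have bdB: "bdd_below (E \<inter> {y..})" by (auto simp: bdd_below_def)
  have "\<beta>' \<in> E \<inter> {y..}" unfolding \<beta>'_def
    by (rule closed_contains_Inf[OF neB bdB]) (simp add: clE closed_Int)
  then have \<beta>': "\<beta>' \<in> E" "y < \<beta>'" using y by (auto simp: less_le)
  have gap: "x \<notin> E" if "\<alpha>' < x" "x < \<beta>'" for x
  proof
    assume "x \<in> E"
    then show False
      using that cSup_upper[OF _ bdA, of x] cInf_lower[OF _ bdB, of x]
      unfolding \<alpha>'_def[symmetric] \<beta>'_def[symmetric] by (cases "x \<le> y") auto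
  qed
  \<comment> \<open>A point \<open>c\<close> of the gap is chosen with \<open>W \<alpha>' c\<close>
    nonzero; this value is the invariant that the images of the gap cannot lose.\<close>
  have "\<forall>\<^sub>F c in at_right \<alpha>'. c < \<beta>'"
    using \<alpha>' \<beta>' by (intro order_tendstoD(2)[OF tendsto_ident_at]) auto
  moreover have "\<forall>\<^sub>F c in at_right \<alpha>'. c > \<alpha>'" by (simp add: eventually_at_filter)
  ultimately have "\<forall>\<^sub>F c in at_right \<alpha>'. \<alpha>' < c \<and> c < \<beta>' \<and> W \<alpha>' c \<noteq> 0"
    using W_right_nonzero by eventually_elim simp
  then obtain c where c: "\<alpha>' < c" "c < \<beta>'" "W \<alpha>' c \<noteq> 0"
    using eventually_happens[of _ "at_right \<alpha>'"] by auto
  obtain \<delta> where \<delta>: "\<delta> > 0" "\<And>x y. \<bar>x - y\<bar> < \<delta> \<Longrightarrow> \<bar>W x y\<bar> < \<bar>W \<alpha>' c\<bar>"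
    using W_small[of "\<bar>W \<alpha>' c\<bar>"] c(3) by auto
  \<comment> \<open>Two images of the left endpoint \<open>\<alpha>'\<close> lie within
    \<open>\<delta>\<close>. The right one belongs to the orbit closure and so lies beyond the gap
    image that starts at the left one; that gap image is then shorter than
    \<open>\<delta>\<close>.\<close>
  obtain n k and m l :: int where nk: "(F ^^ n) \<alpha>' + of_int m < (F ^^ k) \<alpha>' + of_int l"
    "(F ^^ k) \<alpha>' + of_int l < (F ^^ n) \<alpha>' + of_int m + \<delta>"
    using orbit_close_pair[OF \<delta>(1)] by blast
  have mono_n: "(F ^^ n) x < (F ^^ n) x' \<longleftrightarrow> x < x'" for x x'
    by (induction n) simp_all
  have surj_n: "\<exists>x'. (F ^^ n) x' = x" for x
    using bij_is_surj[OF bij_F] by (metis surj_fn surjD)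
  have "full_orbit t \<inter> {(F ^^ n) \<alpha>' + of_int m<..<(F ^^ n) \<beta>' + of_int m} = {}"
  proof (rule ccontr)
    assume "\<not> ?thesis"
    then obtain x where x: "x \<in> full_orbit t" "(F ^^ n) \<alpha>' + of_int m < x" "x < (F ^^ n) \<beta>' + of_int m" by auto
    obtain x' where x': "(F ^^ n) x' = x - of_int m" using surj_n by blast
    have "(F ^^ n) x' \<in> full_orbit t" using full_orbit_add_int[OF x(1), of "- m"] x' by simp
    then have "x' \<in> E" unfolding E_def funpow_full_orbit_iff using closure_subset by blast
    moreover have "\<alpha>' < x'" "x' < \<beta>'" using x x' mono_n[of \<alpha>' x'] mono_n[of x' \<beta>'] by auto
    ultimately show False using gap by blast
  qed
  then have "E \<inter> {(F ^^ n) \<alpha>' + of_int m<..<(F ^^ n) \<beta>' + of_int m} = {}"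
    unfolding E_def Int_commute[of _ "{_<..<_}"] open_Int_closure_eq_empty[OF open_greaterThanLessThan] .
  moreover have "(F ^^ k) \<alpha>' + of_int l \<in> E"
    using \<alpha>'(1) closure_full_orbit_funpow unfolding E_def by blast
  ultimately have "(F ^^ k) \<alpha>' + of_int l \<notin> {(F ^^ n) \<alpha>' + of_int m<..<(F ^^ n) \<beta>' + of_int m}" by blast
  then have "(F ^^ n) \<beta>' + of_int m \<le> (F ^^ k) \<alpha>' + of_int l" using nk(1) by simp
  moreover have "(F ^^ n) \<alpha>' < (F ^^ n) c" "(F ^^ n) c < (F ^^ n) \<beta>'" using c mono_n by auto
  ultimately have "\<bar>(F ^^ n) \<alpha>' - (F ^^ n) c\<bar> < \<delta>" using nk(2) by linarith
  then have "\<bar>W ((F ^^ n) \<alpha>') ((F ^^ n) c)\<bar> < \<bar>W \<alpha>' c\<bar>" by (rule \<delta>(2))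
  then show False by (simp add: W_funpow)
qed

end

section \<open>Conic arcs and orbit closures\<close>

definition conic_form :: "real \<Rightarrow> conic_type" where
  "conic_form \<Delta> = (if \<Delta> > 0 then Ellipse else if \<Delta> < 0 then Hyperbola else Line)"

text \<open>Arcs are compared as sets, so continuity of the parameter change suffices: its image is
  a compact interval, nondegenerate because the endpoints of \<open>P\<close> differ.\<close>

lemma reparam_image:
  fixes \<Theta> :: "real \<Rightarrow> real"
  assumes "c \<le> d" and cont: "continuous_on {c..d} \<Theta>"
    and eq: "\<And>s. s \<in> {c..d} \<Longrightarrow> P s = E (\<Theta> s)" and ne: "P c \<noteq> P d"
  obtains t0 t1 where "t0 < t1" "P ` {c..d} = E ` {t0..t1}"
proof -
  obtain t0 t1 where im: "\<Theta> ` {c..d} = {t0..t1}" and le: "t0 \<le> t1"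
    using continuous_image_closed_interval[OF \<open>c \<le> d\<close> cont] by blast
  have "P ` {c..d} = E ` \<Theta> ` {c..d}" using eq by (auto simp: image_image)
  moreover have "t0 \<noteq> t1"
  proof
    assume "t0 = t1"
    then have "\<Theta> c = \<Theta> d" using im \<open>c \<le> d\<close> by (metis atLeastAtMost_iff atLeastAtMost_singleton imageI order_refl singletonD)
    then show False using eq[of c] eq[of d] ne \<open>c \<le> d\<close> by simp
  qed
  ultimately show ?thesis using that le im by (metis less_le)
qed

text \<open>Positivity of \<open>X\<close> confines the points to half of an ellipse, one branch of
  a hyperbola, or one of two parallel lines. There \<open>arctan\<close>, \<open>arsinh\<close> and
  \<open>Y\<close> itself are global parameters.\<close>

lemma conic_arc_of_norm_form:
  fixes X Y :: "real \<Rightarrow> real"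
  assumes "c \<le> d" and cont: "continuous_on {c..d} X" "continuous_on {c..d} Y"
    and pos: "\<And>s. s \<in> {c..d} \<Longrightarrow> X s > 0"
    and one: "\<And>s. s \<in> {c..d} \<Longrightarrow> (X s)\<^sup>2 + \<Delta> * (Y s)\<^sup>2 = 1"
    and P: "\<And>s. s \<in> {c..d} \<Longrightarrow> P s = X s *\<^sub>R u + Y s *\<^sub>R v"
    and ne: "P c \<noteq> P d" and uv: "wedge u v \<noteq> 0"
  shows "conic_arc (conic_form \<Delta>) (P ` {c..d})"
proof (cases "\<Delta>" "0 :: real" rule: linorder_cases)
  case equal
  have X1: "X s = 1" if "s \<in> {c..d}" for s
    using one[OF that] pos[OF that] equal by (simp add: power2_eq_1_iff)
  have "P s = u + Y s *\<^sub>R v" if "s \<in> {c..d}" for s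
    using X1 P that by simp
  then obtain t0 t1 where "t0 < t1" "P ` {c..d} = (\<lambda>t. u + t *\<^sub>R v) ` {t0..t1}"
    using reparam_image[OF \<open>c \<le> d\<close> cont(2), of P "\<lambda>t. u + t *\<^sub>R v"] ne by blast
  moreover have "v \<noteq> 0" using uv by (auto simp: wedge_def)
  ultimately show ?thesis
    unfolding conic_arc_def using equal by (auto simp: conic_form_def simp del: split_paired_Ex)
next
  case greater
  define \<omega> where "\<omega> = sqrt \<Delta>"
  have \<omega>: "\<omega> > 0" "\<omega>\<^sup>2 = \<Delta>" using greater by (simp_all add: \<omega>_def)
  define \<Theta> where "\<Theta> s = arctan (\<omega> * Y s / X s)" for s
  have ct: "continuous_on {c..d} \<Theta>"
    unfolding \<Theta>_def using pos by (intro continuous_intros cont) fastforce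
  have "P s = 0 + cos (\<Theta> s) *\<^sub>R u + sin (\<Theta> s) *\<^sub>R (1 / \<omega>) *\<^sub>R v" if s: "s \<in> {c..d}" for s
  proof -
    have "1 + (\<omega> * Y s / X s)\<^sup>2 = ((X s)\<^sup>2 + \<Delta> * (Y s)\<^sup>2) / (X s)\<^sup>2"
      using pos[OF s] \<omega> by (simp add: field_simps power_mult_distrib power_divide)
    also have "\<dots> = (1 / X s)\<^sup>2" using one[OF s] by (simp add: power_divide)
    finally have "sqrt (1 + (\<omega> * Y s / X s)\<^sup>2) = 1 / X s" using pos[OF s] by simp
    then have "cos (\<Theta> s) = X s" "sin (\<Theta> s) = \<omega> * Y s"
      using pos[OF s] by (simp_all add: \<Theta>_def cos_arctan sin_arctan)
    then show ?thesis using P[OF s] \<omega> by simp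
  qed
  then obtain t0 t1 where "t0 < t1"
    "P ` {c..d} = (\<lambda>t. 0 + cos t *\<^sub>R u + sin t *\<^sub>R (1 / \<omega>) *\<^sub>R v) ` {t0..t1}"
    using reparam_image[OF \<open>c \<le> d\<close> ct, of P "\<lambda>t. 0 + cos t *\<^sub>R u + sin t *\<^sub>R (1 / \<omega>) *\<^sub>R v"] ne by blast
  moreover have "lin_indep2 u ((1 / \<omega>) *\<^sub>R v)"
    using uv \<omega> by (simp add: lin_indep2_def wedge_def field_simps)
  moreover have "conic_form \<Delta> = Ellipse" using greater by (simp add: conic_form_def)
  ultimately show ?thesis unfolding conic_arc_def by (simp only: conic_type.case) blast
next
  case less
  define \<omega> where "\<omega> = sqrt (- \<Delta>)"
  have \<omega>: "\<omega> > 0" "\<omega>\<^sup>2 = - \<Delta>" using less by (simp_all add: \<omega>_def)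
  define \<Theta> where "\<Theta> s = arsinh (\<omega> * Y s)" for s
  have ct: "continuous_on {c..d} \<Theta>"
    unfolding \<Theta>_def by (intro continuous_intros cont)
  have "P s = 0 + cosh (\<Theta> s) *\<^sub>R u + sinh (\<Theta> s) *\<^sub>R (1 / \<omega>) *\<^sub>R v" if s: "s \<in> {c..d}" for s
  proof -
    have "(\<omega> * Y s)\<^sup>2 + 1 = (X s)\<^sup>2" using one[OF s] \<omega> by (simp add: power_mult_distrib algebra_simps)
    then have "cosh (\<Theta> s) = X s" "sinh (\<Theta> s) = \<omega> * Y s"
      using pos[OF s] by (simp_all add: \<Theta>_def cosh_arsinh_real)
    then show ?thesis using P[OF s] \<omega> by simp
  qed
  then obtain t0 t1 where "t0 < t1"
    "P ` {c..d} = (\<lambda>t. 0 + cosh t *\<^sub>R u + sinh t *\<^sub>R (1 / \<omega>) *\<^sub>R v) ` {t0..t1}"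
    using reparam_image[OF \<open>c \<le> d\<close> ct, of P "\<lambda>t. 0 + cosh t *\<^sub>R u + sinh t *\<^sub>R (1 / \<omega>) *\<^sub>R v"] ne by blast
  moreover have "lin_indep2 u ((1 / \<omega>) *\<^sub>R v)"
    using uv \<omega> by (simp add: lin_indep2_def wedge_def field_simps)
  moreover have "conic_form \<Delta> = Hyperbola" using less by (simp add: conic_form_def)
  ultimately show ?thesis unfolding conic_arc_def by (simp only: conic_type.case) blast
qed

section \<open>Arcs of the level curves, and orbit closures\<close>

context positive_bent_form
begin

text \<open>With fixed \<open>u\<close>, \<open>v\<close> the point \<open>g s\<close> depends
  linearly on \<open>(h1 s, h2 s)\<close>, which lies on the conic where \<open>qform\<close> is 1.
  The base point \<open>(x0, y0)\<close> of that conic serves as first basis vector, and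
  \<open>pos\<close> keeps its coordinate \<open>X\<close> positive. The bound
  \<open>d < c + 1\<close> keeps the endpoints distinct.\<close>

lemma conic_arc_segment:
  assumes \<mu>: "\<mu> > 0" and cd: "c < d" "d < c + 1" and uv: "wedge u v = 1"
    and f: "\<And>s. s \<in> {c..d} \<Longrightarrow> f1 s = wedge u (circ s) \<and> f2 s = wedge v (circ s)"
    and base: "qform \<alpha> \<beta> \<gamma> x0 y0 = 1"
    and pos: "\<And>s. s \<in> {c..d} \<Longrightarrow> h1 s * (2 * \<alpha> * x0 + \<beta> * y0) + h2 s * (\<beta> * x0 + 2 * \<gamma> * y0) > 0"
  shows "conic_arc (conic_form (4 * \<alpha> * \<gamma> - \<beta>\<^sup>2)) ((\<lambda>s. \<mu> *\<^sub>R g s) ` {c..d})"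
proof -
  \<comment> \<open>\<open>(k1, k2)\<close> is orthogonal to \<open>(x0, y0)\<close> with respect to the polar form, with value the
    negated discriminant, so the form is \<open>X\<^sup>2 + (4 \<alpha> \<gamma> - \<beta>\<^sup>2) Y\<^sup>2\<close> in this basis.\<close>
  define k1 k2 where "k1 = - (\<beta> * x0 + 2 * \<gamma> * y0)" and "k2 = 2 * \<alpha> * x0 + \<beta> * y0"
  have k: "x0 * k2 - y0 * k1 = 2"
    using base by (simp add: k1_def k2_def qform_def power2_eq_square algebra_simps)
  define X Y where "X s = (h1 s * k2 - h2 s * k1) / 2" and "Y s = (x0 * h2 s - y0 * h1 s) / 2" for s
  have XY: "h1 s = x0 * X s + k1 * Y s" "h2 s = y0 * X s + k2 * Y s" for s
  proof -
    have "2 * (x0 * X s + k1 * Y s) = (x0 * k2 - y0 * k1) * h1 s"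
      "2 * (y0 * X s + k2 * Y s) = (x0 * k2 - y0 * k1) * h2 s"
      by (simp_all add: X_def Y_def field_simps)
    then show "h1 s = x0 * X s + k1 * Y s" "h2 s = y0 * X s + k2 * Y s" by (simp_all add: k)
  qed
  show ?thesis
  proof (rule conic_arc_of_norm_form[where X = X and Y = Y
        and u = "\<mu> *\<^sub>R (x0 *\<^sub>R v - y0 *\<^sub>R u)" and v = "\<mu> *\<^sub>R (k1 *\<^sub>R v - k2 *\<^sub>R u)"])
    show "continuous_on {c..d} X" "continuous_on {c..d} Y"
      unfolding X_def Y_def by (intro continuous_intros continuous_h; simp)+
    show "X s > 0" if "s \<in> {c..d}" for s
      using pos[OF that] by (simp add: X_def k1_def k2_def algebra_simps)
    show "(X s)\<^sup>2 + (4 * \<alpha> * \<gamma> - \<beta>\<^sup>2) * (Y s)\<^sup>2 = 1" for s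
    proof -
      have "qform \<alpha> \<beta> \<gamma> k1 k2 = (4 * \<alpha> * \<gamma> - \<beta>\<^sup>2) * qform \<alpha> \<beta> \<gamma> x0 y0"
        by (simp add: qform_def k1_def k2_def power2_eq_square algebra_simps)
      moreover have "2 * \<alpha> * x0 * k1 + \<beta> * (x0 * k2 + k1 * y0) + 2 * \<gamma> * y0 * k2 = 0"
        by (simp add: k1_def k2_def algebra_simps)
      moreover have "qform \<alpha> \<beta> \<gamma> (x0 * X s + k1 * Y s) (y0 * X s + k2 * Y s) = 1"
        using qform_h[of s] unfolding XY .
      ultimately show ?thesis unfolding qform_comb base by (simp add: qform_def)
    qed
    show "\<mu> *\<^sub>R g s = X s *\<^sub>R \<mu> *\<^sub>R (x0 *\<^sub>R v - y0 *\<^sub>R u) + Y s *\<^sub>R \<mu> *\<^sub>R (k1 *\<^sub>R v - k2 *\<^sub>R u)"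
      if s: "s \<in> {c..d}" for s
    proof -
      have "wedge u (g s) = h1 s" "wedge v (g s) = h2 s"
        using f[OF s] by (simp_all add: g_def h1_def h2_def wedge_simps)
      then have gs: "g s = (x0 * X s + k1 * Y s) *\<^sub>R v - (y0 * X s + k2 * Y s) *\<^sub>R u"
        using wedge_expand[OF uv, of "g s"] unfolding XY by simp
      show ?thesis unfolding gs by (simp add: algebra_simps)
    qed
    show "\<mu> *\<^sub>R g c \<noteq> \<mu> *\<^sub>R g d"
    proof
      assume "\<mu> *\<^sub>R g c = \<mu> *\<^sub>R g d"
      then obtain m :: int where "d = c + of_int m" using g_eqD[of d c] \<mu> by auto
      then have "0 < real_of_int m" "real_of_int m < 1" using cd by auto
      then show False by simp
    qed
    have "wedge (\<mu> *\<^sub>R (x0 *\<^sub>R v - y0 *\<^sub>R u)) (\<mu> *\<^sub>R (k1 *\<^sub>R v - k2 *\<^sub>R u))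
        = \<mu>\<^sup>2 * ((x0 * k2 - y0 * k1) * wedge u v)"
      using wedge_commute[of v u] by (simp add: wedge_simps power2_eq_square algebra_simps)
    then show "wedge (\<mu> *\<^sub>R (x0 *\<^sub>R v - y0 *\<^sub>R u)) (\<mu> *\<^sub>R (k1 *\<^sub>R v - k2 *\<^sub>R u)) \<noteq> 0"
      using \<mu> by (simp add: k uv)
  qed (use cd in simp)
qed

text \<open>One arc on each side, since the linear formula may change at a kink. The base point is
  \<open>(h1 t, h2 t)\<close>; its polar form \<open>\<phi>\<close> takes the value 2 at
  \<open>t\<close> and so stays positive nearby.\<close>

lemma conic_arcs_locally:
  assumes \<mu>: "\<mu> > 0"
  obtains \<epsilon> where "\<epsilon> > 0" "conic_arc (conic_form (4 * \<alpha> * \<gamma> - \<beta>\<^sup>2)) ((\<lambda>s. \<mu> *\<^sub>R g s) ` {t - \<epsilon>..t})"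
    "conic_arc (conic_form (4 * \<alpha> * \<gamma> - \<beta>\<^sup>2)) ((\<lambda>s. \<mu> *\<^sub>R g s) ` {t..t + \<epsilon>})"
proof -
  define \<phi> where "\<phi> s = h1 s * (2 * \<alpha> * h1 t + \<beta> * h2 t) + h2 s * (\<beta> * h1 t + 2 * \<gamma> * h2 t)" for s
  have "continuous_on UNIV \<phi>"
    unfolding \<phi>_def by (intro continuous_intros continuous_h)
  then have "(\<phi> \<longlongrightarrow> \<phi> t) (at t)" by (simp add: continuous_on_def)
  moreover have \<phi>t: "\<phi> t > 0"
    using qform_h[of t] by (simp add: \<phi>_def qform_def power2_eq_square algebra_simps)
  ultimately have "\<forall>\<^sub>F s in at t. \<phi> s > 0" by (rule order_tendstoD(1))
  then have \<phi>: "\<forall>\<^sub>F s in at_left t. \<phi> s > 0" "\<forall>\<^sub>F s in at_right t. \<phi> s > 0"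
    by (simp_all add: eventually_at_split)
  obtain u v where uv: "wedge u v = 1" "f1 t = wedge u (circ t)" "f2 t = wedge v (circ t)"
    and evl: "\<forall>\<^sub>F s in at_left t. f1 s = wedge u (circ s) \<and> f2 s = wedge v (circ s)"
    by (rule f_left[of t])
  obtain l where l: "l < t" "\<And>s. l < s \<Longrightarrow> s < t \<Longrightarrow> \<phi> s > 0 \<and> f1 s = wedge u (circ s) \<and> f2 s = wedge v (circ s)"
    using eventually_conj[OF \<phi>(1) evl] unfolding eventually_at_left_field by blast
  obtain e where e: "e > t" "\<And>s. t < s \<Longrightarrow> s < e \<Longrightarrow> \<phi> s > 0 \<and> f1 s = wedge (p1 t) (circ s) \<and> f2 s = wedge (p2 t) (circ s)"
    using eventually_conj[OF \<phi>(2) f_right] unfolding eventually_at_right_field by blast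
  define \<epsilon> where "\<epsilon> = min (1/2) (min ((t - l) / 2) ((e - t) / 2))"
  have \<epsilon>: "\<epsilon> > 0" "\<epsilon> < 1" "l < t - \<epsilon>" "t + \<epsilon> < e"
    using l(1) e(1) unfolding \<epsilon>_def by (auto simp: min_def field_simps)
  show ?thesis
  proof (rule that[OF \<epsilon>(1)])
    show "conic_arc (conic_form (4 * \<alpha> * \<gamma> - \<beta>\<^sup>2)) ((\<lambda>s. \<mu> *\<^sub>R g s) ` {t - \<epsilon>..t})"
    proof (rule conic_arc_segment[OF \<mu> _ _ uv(1) _ qform_h[of t]])
      fix s assume s: "s \<in> {t - \<epsilon>..t}"
      have *: "\<phi> s > 0 \<and> f1 s = wedge u (circ s) \<and> f2 s = wedge v (circ s)"
        using s \<epsilon> l(2)[of s] \<phi>t uv by (cases "s = t") auto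
      then show "f1 s = wedge u (circ s) \<and> f2 s = wedge v (circ s)" by simp
      from * show "h1 s * (2 * \<alpha> * h1 t + \<beta> * h2 t) + h2 s * (\<beta> * h1 t + 2 * \<gamma> * h2 t) > 0"
        by (simp add: \<phi>_def)
    qed (use \<epsilon> in auto)
    show "conic_arc (conic_form (4 * \<alpha> * \<gamma> - \<beta>\<^sup>2)) ((\<lambda>s. \<mu> *\<^sub>R g s) ` {t..t + \<epsilon>})"
    proof (rule conic_arc_segment[OF \<mu> _ _ wedge_p[of t] _ qform_h[of t]])
      fix s assume s: "s \<in> {t..t + \<epsilon>}"
      have *: "\<phi> s > 0 \<and> f1 s = wedge (p1 t) (circ s) \<and> f2 s = wedge (p2 t) (circ s)"
        using s \<epsilon> e(2)[of s] \<phi>t by (cases "s = t") (auto simp: f1_def f2_def)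
      then show "f1 s = wedge (p1 t) (circ s) \<and> f2 s = wedge (p2 t) (circ s)" by simp
      from * show "h1 s * (2 * \<alpha> * h1 t + \<beta> * h2 t) + h2 s * (\<beta> * h1 t + 2 * \<gamma> * h2 t) > 0"
        by (simp add: \<phi>_def)
    qed (use \<epsilon> in auto)
  qed
qed

lemma range_g: "range (\<lambda>s. \<mu> *\<^sub>R g s) = (\<lambda>s. \<mu> *\<^sub>R g s) ` {0..1}"
proof
  show "range (\<lambda>s. \<mu> *\<^sub>R g s) \<subseteq> (\<lambda>s. \<mu> *\<^sub>R g s) ` {0..1}"
  proof
    fix x assume "x \<in> range (\<lambda>s. \<mu> *\<^sub>R g s)"
    then obtain s where "x = \<mu> *\<^sub>R g s" by auto
    also have "g s = g (s + of_int (- \<lfloor>s\<rfloor>))" by (simp only: g_add_int)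
    finally show "x \<in> (\<lambda>s. \<mu> *\<^sub>R g s) ` {0..1}"
      by (rule image_eqI) (simp; linarith)
  qed
qed auto

text \<open>Compactness of one period leaves finitely many arcs. A single \<open>k\<close> serves
  all of them because the discriminant belongs to the form and is the same in every sector.\<close>

lemma finite_conic_arcs:
  assumes \<mu>: "\<mu> > 0"
  shows "\<exists>k \<A>. finite \<A> \<and> range (\<lambda>s. \<mu> *\<^sub>R g s) = \<Union>\<A> \<and> (\<forall>A\<in>\<A>. conic_arc k A)"
proof -
  define k where "k = conic_form (4 * \<alpha> * \<gamma> - \<beta>\<^sup>2)"
  let ?G = "\<lambda>s. \<mu> *\<^sub>R g s"
  have "\<exists>\<epsilon>. \<epsilon> > 0 \<and> conic_arc k (?G ` {t - \<epsilon>..t}) \<and> conic_arc k (?G ` {t..t + \<epsilon>})" for t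
    by (rule conic_arcs_locally[OF \<mu>, of t, folded k_def]) blast
  then have "\<forall>t. \<exists>\<epsilon>. \<epsilon> > 0 \<and> conic_arc k (?G ` {t - \<epsilon>..t}) \<and> conic_arc k (?G ` {t..t + \<epsilon>})"
    by blast
  from choice[OF this] obtain \<epsilon> where \<epsilon>: "\<And>t. \<epsilon> t > 0" "\<And>t. conic_arc k (?G ` {t - \<epsilon> t..t})"
    "\<And>t. conic_arc k (?G ` {t..t + \<epsilon> t})" by blast
  have "{0..1} \<subseteq> (\<Union>t\<in>{0..1}. ball t (\<epsilon> t))" using \<epsilon>(1) by fastforce
  then obtain D where D: "D \<subseteq> {0..1}" "finite D" "{0..1} \<subseteq> (\<Union>t\<in>D. ball t (\<epsilon> t))"
    using compactE_image[OF compact_Icc, of "{0..1}" "\<lambda>t. ball t (\<epsilon> t)" 0 "1 :: real"] by auto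
  define \<A> where "\<A> = (\<lambda>t. ?G ` {t - \<epsilon> t..t}) ` D \<union> (\<lambda>t. ?G ` {t..t + \<epsilon> t}) ` D"
  have "range ?G \<subseteq> \<Union>\<A>"
    unfolding range_g
  proof
    fix x assume "x \<in> ?G ` {0..1}"
    then obtain s where s: "s \<in> {0..1}" "x = ?G s" by auto
    then obtain t where t: "t \<in> D" "\<bar>t - s\<bar> < \<epsilon> t" using D(3) by (auto simp: dist_real_def)
    then have "s \<in> {t - \<epsilon> t..t} \<or> s \<in> {t..t + \<epsilon> t}" by auto
    then show "x \<in> \<Union>\<A>" using t(1) s(2) unfolding \<A>_def by blast
  qed
  moreover have "\<Union>\<A> \<subseteq> range ?G" unfolding \<A>_def by blast
  moreover have "finite \<A>" "\<forall>A\<in>\<A>. conic_arc k A" using D(2) \<epsilon> by (auto simp: \<A>_def)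
  ultimately show ?thesis by blast
qed

text \<open>Since \<open>g s\<close> points in direction \<open>circ s\<close>, a ray determines its
  parameter modulo 1, which gives both simplicity and the unique intersection. Invariance is
  surjectivity of \<open>F\<close>.\<close>

lemma invariant_circle_range:
  assumes \<mu>: "\<mu> > 0"
  shows "invariant_circle a b (range (\<lambda>s. \<mu> *\<^sub>R g s))"
  unfolding invariant_circle_def
proof (intro conjI allI impI)
  let ?G = "\<lambda>s. \<mu> *\<^sub>R g s"
  have "simple_path ?G"
    unfolding simple_path_def path_def loop_free_def
  proof (intro conjI ballI impI)
    show "continuous_on {0..1} ?G" by (intro continuous_intros continuous_g)
    fix x y :: real assume x: "x \<in> {0..1}" and y: "y \<in> {0..1}" and eq: "?G x = ?G y"
    then obtain m :: int where m: "x = y + of_int m" using g_eqD[of x y] \<mu> by auto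
    then have "-1 \<le> real_of_int m" "real_of_int m \<le> 1" using x y by auto
    then have "m = -1 \<or> m = 0 \<or> m = 1" by linarith
    then show "x = y \<or> x = 0 \<and> y = 1 \<or> x = 1 \<and> y = 0" using m x y by auto
  qed
  moreover have "pathfinish ?G = pathstart ?G"
    using g_add_int[of 0 1] by (simp add: pathfinish_def pathstart_def)
  moreover have "path_image ?G = range ?G" by (simp add: path_image_def range_g)
  ultimately show "\<exists>\<gamma>. simple_path \<gamma> \<and> pathfinish \<gamma> = pathstart \<gamma> \<and> path_image \<gamma> = range ?G"
    by (intro exI[of _ ?G] conjI)
  have "\<mu> *\<^sub>R g s \<noteq> 0" for s using \<mu> by simp
  then show "0 \<notin> range ?G" by (simp only: image_iff) (metis (no_types))
  show "T a b ` range ?G = range ?G"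
  proof -
    have "T a b ` range ?G = range (\<lambda>s. T a b (?G s))" by (rule image_image)
    also have "\<dots> = range (\<lambda>s. ?G (F s))"
      using \<mu> by (simp only: T_scaleR[OF less_imp_le] T_g)
    also have "\<dots> = ?G ` range F" by (rule image_image[symmetric])
    also have "\<dots> = range ?G" by (simp only: bij_is_surj[OF bij_F])
    finally show ?thesis .
  qed
  fix u :: "real \<times> real" assume u: "u \<noteq> 0"
  obtain t where t: "u = norm u *\<^sub>R circ t" by (rule polar_coordinates[OF u])
  have nu: "norm u > 0" using u by simp
  define c where "c = \<mu> / (sqrt (Q t) * norm u)"
  have c: "c > 0" using \<mu> Q_pos[of t] nu by (simp add: c_def)
  have cu: "x *\<^sub>R u = (x * norm u) *\<^sub>R circ t" for x
    using arg_cong[OF t, of "scaleR x"] by simp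
  have Gt: "?G t = c *\<^sub>R u" unfolding cu using nu by (simp add: g_def c_def)
  show "\<exists>!p. p \<in> range ?G \<and> (\<exists>t>0. p = t *\<^sub>R u)"
  proof (rule ex1I[of _ "?G t"])
    have ex: "\<exists>d>0. ?G t = d *\<^sub>R u" by (rule exI[of _ c]) (simp only: Gt c simp_thms)
    show "?G t \<in> range ?G \<and> (\<exists>d>0. ?G t = d *\<^sub>R u)" by (rule conjI[OF _ ex]) (rule image_eqI[where x = t], simp_all)
    fix p assume "p \<in> range ?G \<and> (\<exists>t>0. p = t *\<^sub>R u)"
    then obtain s d where s: "p = ?G s" "p = d *\<^sub>R u" "d > 0" by (elim conjE exE rangeE) (rule that)
    have "(\<mu> / sqrt (Q s)) *\<^sub>R circ s = (d * norm u) *\<^sub>R circ t"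
      using s(1,2) unfolding cu by (simp add: g_def)
    then have "circ s = circ t" by (rule circ_scaled_eq) (use \<mu> Q_pos[of s] s(3) nu in simp_all)
    then obtain m :: int where "s = t + of_int m" unfolding circ_eq_iff by blast
    then show "p = ?G t" using s(1) by (simp only: g_add_int)
  qed
qed

lemma Titer_g: "\<exists>s. Titer a b j (g t) = g s"
proof (cases "j \<ge> 0")
  case True
  then show ?thesis by (auto simp: Titer_def int_iter_def funpow_T_g)
next
  case False
  obtain s where "(F ^^ nat (- j)) s = t" using bij_is_surj[OF bij_F] by (metis surj_fn surjD)
  then have "(Tinv a b ^^ nat (- j)) (g t) = g s" by (metis funpow_T_g funpow_Tinv_T)
  then show ?thesis using False by (auto simp: Titer_def int_iter_def inv_T)
qed

lemma g_full_orbit: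
  assumes "s \<in> full_orbit t"
  shows "\<exists>j. g s = Titer a b j (g t)"
proof -
  obtain n k and m :: int where nk: "(F ^^ n) s = (F ^^ k) t + of_int m" using assms by (auto simp: full_orbit_def)
  then have eq: "(T a b ^^ n) (g s) = (T a b ^^ k) (g t)" by (simp add: funpow_T_g)
  show ?thesis
  proof (cases "n \<le> k")
    case True
    then have "(T a b ^^ k) (g t) = (T a b ^^ n) ((T a b ^^ (k - n)) (g t))"
      by (simp flip: funpow_add[THEN fun_cong, unfolded o_apply])
    then have "g s = (T a b ^^ (k - n)) (g t)" using eq by (metis funpow_Tinv_T)
    then show ?thesis by (intro exI[of _ "int (k - n)"]) (simp add: Titer_def int_iter_def)
  next
    case False
    then have "(T a b ^^ n) (g s) = (T a b ^^ k) ((T a b ^^ (n - k)) (g s))"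
      by (simp flip: funpow_add[THEN fun_cong, unfolded o_apply])
    then have "g t = (T a b ^^ (n - k)) (g s)" using eq by (metis funpow_Tinv_T)
    then have "g s = (Tinv a b ^^ (n - k)) (g t)" by simp
    then show ?thesis using False
      by (intro exI[of _ "- int (n - k)"]) (simp add: Titer_def int_iter_def inv_T del: of_nat_diff)
  qed
qed

lemma Titer_scaleR: "c \<ge> 0 \<Longrightarrow> Titer a b j (c *\<^sub>R w) = c *\<^sub>R Titer a b j w"
  by (simp add: Titer_def int_iter_def inv_T funpow_T_scaleR funpow_Tinv_scaleR)

text \<open>The parameters in \<open>full_orbit t\<close> are carried by \<open>g\<close> into the
  orbit of \<open>g t\<close>; they are dense on the line, and continuity transfers density to the
  curve.\<close>

lemma closure_orbit:
  assumes \<mu>: "\<mu> > 0"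
  shows "closure (range (\<lambda>j. Titer a b j (\<mu> *\<^sub>R g t))) = range (\<lambda>s. \<mu> *\<^sub>R g s)"
proof
  let ?G = "\<lambda>s. \<mu> *\<^sub>R g s"
  have contG: "continuous_on A ?G" for A by (intro continuous_intros continuous_g)
  show "closure (range (\<lambda>j. Titer a b j (\<mu> *\<^sub>R g t))) \<subseteq> range ?G"
  proof (rule closure_minimal)
    show "range (\<lambda>j. Titer a b j (\<mu> *\<^sub>R g t)) \<subseteq> range ?G"
    proof
      fix x assume "x \<in> range (\<lambda>j. Titer a b j (\<mu> *\<^sub>R g t))"
      then obtain j where "x = \<mu> *\<^sub>R Titer a b j (g t)" using \<mu> by (auto simp: Titer_scaleR)
      moreover obtain s where "Titer a b j (g t) = g s" using Titer_g by blast
      ultimately have "x = ?G s" by simp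
      then show "x \<in> range ?G" by (rule range_eqI)
    qed
    show "closed (range ?G)"
      unfolding range_g by (intro compact_imp_closed compact_continuous_image contG compact_Icc)
  qed
  have "?G ` closure (full_orbit t) \<subseteq> closure (range (\<lambda>j. Titer a b j (\<mu> *\<^sub>R g t)))"
  proof (rule image_closure_subset[OF contG closed_closure])
    show "?G ` full_orbit t \<subseteq> closure (range (\<lambda>j. Titer a b j (\<mu> *\<^sub>R g t)))"
    proof
      fix x assume "x \<in> ?G ` full_orbit t"
      then obtain s where s: "x = ?G s" "s \<in> full_orbit t" by (elim imageE)
      obtain j where "g s = Titer a b j (g t)" using g_full_orbit[OF s(2)] by (elim exE)
      then have "x = Titer a b j (\<mu> *\<^sub>R g t)" using \<mu> s(1) by (simp add: Titer_scaleR)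
      then have "x \<in> range (\<lambda>j. Titer a b j (\<mu> *\<^sub>R g t))" by (rule range_eqI)
      then show "x \<in> closure (range (\<lambda>j. Titer a b j (\<mu> *\<^sub>R g t)))"
        by (rule closure_subset[THEN subsetD])
    qed
  qed
  then show "range ?G \<subseteq> closure (range (\<lambda>j. Titer a b j (\<mu> *\<^sub>R g t)))" by (simp add: full_orbit_dense)
qed

lemma orbit_closure_properties:
  assumes "w \<noteq> 0" and C: "C = closure (range (\<lambda>j. Titer a b j w))"
  shows "invariant_circle a b C \<and> (\<exists>k \<A>. finite \<A> \<and> C = \<Union>\<A> \<and> (\<forall>A\<in>\<A>. conic_arc k A))"
proof -
  obtain t where t: "w = norm w *\<^sub>R circ t" by (rule polar_coordinates[OF \<open>w \<noteq> 0\<close>])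
  define \<mu> where "\<mu> = norm w * sqrt (Q t)"
  have \<mu>: "\<mu> > 0" using \<open>w \<noteq> 0\<close> Q_pos[of t] by (simp add: \<mu>_def)
  have "w = \<mu> *\<^sub>R g t" by (subst t) (use Q_pos[of t] in \<open>simp add: \<mu>_def g_def\<close>)
  then have "C = range (\<lambda>s. \<mu> *\<^sub>R g s)" using closure_orbit[OF \<mu>] C by simp
  then show ?thesis using invariant_circle_range[OF \<mu>] finite_conic_arcs[OF \<mu>] by simp
qed

end

text \<open>The form has no zeros along the curve but its sign is unknown. The negated coefficients
  satisfy the same assumptions, so both versions are interpreted and the one positive at
  \<open>0\<close> is used.\<close>

lemma (in half_turn_lift) orbit_closure_invariant_circle:
  assumes "w \<noteq> 0" and "C = closure (range (\<lambda>j. Titer a b j w))"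
  shows "invariant_circle a b C \<and> (\<exists>k \<A>. finite \<A> \<and> C = \<Union>\<A> \<and> (\<forall>A\<in>\<A>. conic_arc k A))"
proof -
  obtain p1 p2 a11 a12 a21 a22 h11 h12 h21 h22 where basis:
    "solves kinks p1" "solves kinks p2" "\<And>t. wedge (p1 t) (p2 t) = 1"
    "\<And>t. pull p1 t = a11 *\<^sub>R p1 t + a12 *\<^sub>R p2 t" "\<And>t. pull p2 t = a21 *\<^sub>R p1 t + a22 *\<^sub>R p2 t"
    "\<And>t. p1 (t + 1) = h11 *\<^sub>R p1 t + h12 *\<^sub>R p2 t" "\<And>t. p2 (t + 1) = h21 *\<^sub>R p1 t + h22 *\<^sub>R p2 t"
    "a11 * a22 - a12 * a21 = 1" "h11 * h22 - h12 * h21 = 1"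
    and comm: "a12 * h21 = h12 * a21" "a11 * h12 + a12 * h22 = h11 * a12 + h12 * a22"
    "a21 * h11 + a22 * h21 = h21 * a11 + h22 * a21"
    by (rule solution_basis) (rule that; assumption)
  obtain \<alpha> \<beta> \<gamma> where form: "\<alpha> \<noteq> 0 \<or> \<beta> \<noteq> 0 \<or> \<gamma> \<noteq> 0"
    "\<And>x y. qform \<alpha> \<beta> \<gamma> (a11 * x + a12 * y) (a21 * x + a22 * y) = qform \<alpha> \<beta> \<gamma> x y"
    "\<And>x y. qform \<alpha> \<beta> \<gamma> (h11 * x + h12 * y) (h21 * x + h22 * y) = qform \<alpha> \<beta> \<gamma> x y"
    by (rule invariant_qform[OF basis(8,9) comm]) blast
  interpret pos: bent_form a b F kinks p1 p2 a11 a12 a21 a22 h11 h12 h21 h22 \<alpha> \<beta> \<gamma>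
    by unfold_locales (fact basis form)+
  interpret neg: bent_form a b F kinks p1 p2 a11 a12 a21 a22 h11 h12 h21 h22 "- \<alpha>" "- \<beta>" "- \<gamma>"
    by unfold_locales (use basis form in \<open>simp_all add: qform_minus\<close>)
  have "neg.Q 0 = - pos.Q 0"
    by (simp add: neg.Q_def pos.Q_def neg.f1_def neg.f2_def pos.f1_def pos.f2_def qform_minus)
  then consider "pos.Q 0 > 0" | "neg.Q 0 > 0" using pos.Q_nonzero[of 0] by linarith
  then show ?thesis
  proof cases
    case 1
    interpret positive_bent_form a b F kinks p1 p2 a11 a12 a21 a22 h11 h12 h21 h22 \<alpha> \<beta> \<gamma>
      by unfold_locales (rule 1)
    show ?thesis using assms by (rule orbit_closure_properties)
  next
    case 2
    interpret positive_bent_form a b F kinks p1 p2 a11 a12 a21 a22 h11 h12 h21 h22 "- \<alpha>" "- \<beta>" "- \<gamma>"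
      by unfold_locales (rule 2)
    show ?thesis using assms by (rule orbit_closure_properties)
  qed
qed

theorem theorem2p2:
  fixes a b :: real
  assumes "\<exists>rho. rotation_number (S a b) rho \<and> rho \<notin> \<rat>"
    and "\<exists>j::int. Siter a b j (0, 1) = (0, -1)"
  shows "(\<exists>j::int. Titer a b j (0, 1) = (0, -1)) \<and>
    (\<forall>w::real \<times> real. w \<noteq> 0 \<longrightarrow>
       (let C = closure (range (\<lambda>j::int. Titer a b j w)) in
          invariant_circle a b C \<and>
          (\<exists>k \<A>. finite \<A> \<and> C = \<Union>\<A> \<and> (\<forall>A\<in>\<A>. conic_arc k A))))"
proof -
  obtain rho where rho: "rotation_number (S a b) rho" "rho \<notin> \<rat>" using assms(1) by blast
  obtain j where j: "Siter a b j (0, 1) = (0, -1)" using assms(2) by blast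
  obtain z N where zN: "z = (0, 1) \<or> z = (0, -1)" "(T a b ^^ N) z = - z" "Titer a b j (0, 1) = (0, -1)"
    by (rule half_turn_orbit[OF j])
  obtain F where F: "continuous_on UNIV F" "strict_mono F" "\<And>t. F (t + 1) = F t + 1"
    "\<And>t. S a b (circ t) = circ (F t)" "\<And>n t m. n > 0 \<Longrightarrow> (F ^^ n) t \<noteq> t + of_int m"
    by (rule irrational_rotation_lift[OF rho inj_on_S]) blast
  interpret half_turn_lift a b F z N
    by unfold_locales (fact F zN)+
  show ?thesis
    unfolding Let_def by (intro conjI allI impI exI[of _ j] zN(3) orbit_closure_invariant_circle[OF _ refl, THEN conjunct1]
      orbit_closure_invariant_circle[OF _ refl, THEN conjunct2])
qed

end
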